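(* Let $\mathcal{E}$ be a locally cartesian closed, lextensive and regular category. Then $\mathcal{E}$ satisfies the reflection principle RP (every map of $\mathcal{E}$ belongs to a representable class of small maps) if and only if $\mathcal{E}$ satisfies the Strong Axiom of Multiple Choice SAMC (every map of $\mathcal{E}$ is the right-hand side of a square that is both a covering square and a strong collection square).
   Context: Categories. A cover is a map $f:B\to A$ such that the only subobject of $A$ through which $f$ factors is $A$ itself. A category is regular if it has finite limits, every map factors as a cover followed by a mono, and covers are stable under pullback. It is lextensive if it has finite limits and finite sums which are disjoint and stable under pullback. It is locally cartesian closed if it has finite limits and every pullback functor between slices has a right adjoint. A locally cartesian closed, lextensive, regular category is a Heyting category, so has an internal first-order intuitionistic logic (with dependent products and sums). Squares. Squares are oriented: a commutative square has top $q:D\to B$, left $g:D\to C$, right $f:B\to A$, bottom $p:C\to A$ (so $fq=pg$). It is a covering square if $p$ and the canonical map $D\to B\times_A C$ are covers; then we say $g$ covers $f$, and that $f$ is covered by $g$. It is a strong collection square if the following holds in the internal logic: for every $c\in C$ and every cover $e:E\to D_c$ there is $c'\in C$ with $p(c)=p(c')$ and a cover $h:D_{c'}\to D_c$ over $B$ which factors through $e$. (Here $D_c$ is the fibre $g^{-1}(c)$. By the usual Kripke–Joyal reading: for every $c:T\to C$ and every cover $e:E\to T\times_C D$ in $\mathcal{E}$ there are a cover $t:T'\to T$, a map $c':T'\to C$ with $pc'=pct$ and a cover $h:T'\times_{c',C}D\to T'\times_{ct,C}D$ over $T'\times B$ factoring through the pullback of $e$ along $t$.) Small maps. A class of small maps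 in $\mathcal{E}$ is a class $\mathcal{S}$ of maps such that: (S1) if $g$ is a pullback of $f\in\mathcal{S}$ then $g\in\mathcal{S}$; (S2) if $f$ is covered by some $g\in\mathcal{S}$ then $f\in\mathcal{S}$; (S3) for any cover $p:Y\to X$ and any $f:X\to A$ in $\mathcal{S}$ there is a covering square with left side $g:Z\to B$ in $\mathcal{S}$, right side $f:X\to A$, bottom a cover $B\to A$, and top $Z\to X$ of the form $Z\to Y\xrightarrow{p}X$. A representation for $\mathcal{S}$ is a map $\pi:E\to U$ in $\mathcal{S}$ such that every $f\in\mathcal{S}$ is covered by some pullback of $\pi$. $\mathcal{S}$ is representable if it has a representation. *)

theory Defs
  imports Main
begin

section \<open>Categories, functors, finite limits, adjunctions\<close>

record ('o, 'm) cat_struct =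
  Ob :: "'o set"
  Mor :: "'m set"
  Dom :: "'m \<Rightarrow> 'o"
  Cod :: "'m \<Rightarrow> 'o"
  Id :: "'o \<Rightarrow> 'm"
  Comp :: "'m \<Rightarrow> 'm \<Rightarrow> 'm"  (infixl "\<cdot>\<index>" 70)

definition hom :: "('o, 'm) cat_struct \<Rightarrow> 'o \<Rightarrow> 'o \<Rightarrow> 'm set" where
  "hom E A B = {f \<in> Mor E. Dom E f = A \<and> Cod E f = B}"

locale category =
  fixes E :: "('o, 'm) cat_struct" (structure)
  assumes Dom_Ob: "f \<in> Mor E \<Longrightarrow> Dom E f \<in> Ob E"
    and Cod_Ob: "f \<in> Mor E \<Longrightarrow> Cod E f \<in> Ob E"
    and Id_hom: "A \<in> Ob E \<Longrightarrow> Id E A \<in> hom E A A"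
    and Comp_hom: "f \<in> hom E A B \<Longrightarrow> g \<in> hom E B C \<Longrightarrow> g \<cdot> f \<in> hom E A C"
    and Comp_assoc:
      "f \<in> hom E A B \<Longrightarrow> g \<in> hom E B C \<Longrightarrow> h \<in> hom E C D \<Longrightarrow> (h \<cdot> g) \<cdot> f = h \<cdot> (g \<cdot> f)"
    and Comp_Id: "f \<in> hom E A B \<Longrightarrow> f \<cdot> Id E A = f"
    and Id_Comp: "f \<in> hom E A B \<Longrightarrow> Id E B \<cdot> f = f"

text \<open>A functor is given by its object part \<open>Fo\<close> and its arrow part \<open>Fm\<close>; the values outside
  \<open>Ob C\<close> and \<open>Mor C\<close> are irrelevant.\<close>

definition is_functor ::
  "('o, 'm) cat_struct \<Rightarrow> ('p, 'n) cat_struct \<Rightarrow> ('o \<Rightarrow> 'p) \<Rightarrow> ('m \<Rightarrow> 'n) \<Rightarrow> bool" where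
  "is_functor C D Fo Fm \<longleftrightarrow>
     category C \<and> category D \<and>
     (\<forall>X\<in>Ob C. Fo X \<in> Ob D) \<and>
     (\<forall>X Y f. f \<in> hom C X Y \<longrightarrow> Fm f \<in> hom D (Fo X) (Fo Y)) \<and>
     (\<forall>X\<in>Ob C. Fm (Id C X) = Id D (Fo X)) \<and>
     (\<forall>X Y Z f g. f \<in> hom C X Y \<and> g \<in> hom C Y Z \<longrightarrow>
        Fm (g \<cdot>\<^bsub>C\<^esub> f) = Fm g \<cdot>\<^bsub>D\<^esub> Fm f)"

definition is_cone ::
  "('i, 'j) cat_struct \<Rightarrow> ('o, 'm) cat_struct \<Rightarrow> ('i \<Rightarrow> 'o) \<Rightarrow> ('j \<Rightarrow> 'm) \<Rightarrow>
   'o \<Rightarrow> ('i \<Rightarrow> 'm) \<Rightarrow> bool" where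
  "is_cone J C Fo Fm L l \<longleftrightarrow>
     L \<in> Ob C \<and>
     (\<forall>i\<in>Ob J. l i \<in> hom C L (Fo i)) \<and>
     (\<forall>u\<in>Mor J. Fm u \<cdot>\<^bsub>C\<^esub> l (Dom J u) = l (Cod J u))"

definition is_limit ::
  "('i, 'j) cat_struct \<Rightarrow> ('o, 'm) cat_struct \<Rightarrow> ('i \<Rightarrow> 'o) \<Rightarrow> ('j \<Rightarrow> 'm) \<Rightarrow>
   'o \<Rightarrow> ('i \<Rightarrow> 'm) \<Rightarrow> bool" where
  "is_limit J C Fo Fm L l \<longleftrightarrow>
     is_cone J C Fo Fm L l \<and>
     (\<forall>M m. is_cone J C Fo Fm M m \<longrightarrow>
        (\<exists>!k. k \<in> hom C M L \<and> (\<forall>i\<in>Ob J. l i \<cdot>\<^bsub>C\<^esub> k = m i)))"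

text \<open>Up to isomorphism, a finite category has natural numbers as objects and as arrows.\<close>

definition has_finite_limits :: "('o, 'm) cat_struct \<Rightarrow> bool" where
  "has_finite_limits C \<longleftrightarrow>
     (\<forall>(J :: (nat, nat) cat_struct) Fo Fm.
        finite (Ob J) \<and> finite (Mor J) \<and> is_functor J C Fo Fm \<longrightarrow>
        (\<exists>L l. is_limit J C Fo Fm L l))"

definition is_adjunction ::
  "('o, 'm) cat_struct \<Rightarrow> ('p, 'n) cat_struct \<Rightarrow> ('o \<Rightarrow> 'p) \<Rightarrow> ('m \<Rightarrow> 'n) \<Rightarrow>
   ('p \<Rightarrow> 'o) \<Rightarrow> ('n \<Rightarrow> 'm) \<Rightarrow> ('o \<Rightarrow> 'p \<Rightarrow> 'n \<Rightarrow> 'm) \<Rightarrow> bool" where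
  "is_adjunction C D Fo Fm Go Gm \<phi> \<longleftrightarrow>
     is_functor C D Fo Fm \<and> is_functor D C Go Gm \<and>
     (\<forall>X\<in>Ob C. \<forall>Y\<in>Ob D. bij_betw (\<phi> X Y) (hom D (Fo X) Y) (hom C X (Go Y))) \<and>
     (\<forall>X X' Y Y' a b f.
        a \<in> hom C X' X \<and> b \<in> hom D Y Y' \<and> f \<in> hom D (Fo X) Y \<longrightarrow>
        \<phi> X' Y' (b \<cdot>\<^bsub>D\<^esub> f \<cdot>\<^bsub>D\<^esub> Fm a) = Gm b \<cdot>\<^bsub>C\<^esub> \<phi> X Y f \<cdot>\<^bsub>C\<^esub> a)"

definition has_right_adjoint ::
  "('o, 'm) cat_struct \<Rightarrow> ('p, 'n) cat_struct \<Rightarrow> ('o \<Rightarrow> 'p) \<Rightarrow> ('m \<Rightarrow> 'n) \<Rightarrow> bool" where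
  "has_right_adjoint C D Fo Fm \<longleftrightarrow> (\<exists>Go Gm \<phi>. is_adjunction C D Fo Fm Go Gm \<phi>)"

text \<open>An arrow of the slice over \<open>A\<close> is a triple \<open>(f, h, g)\<close> with \<open>h\<close> an arrow from \<open>f\<close> to \<open>g\<close> over \<open>A\<close>;
  the triple records its domain and codomain.\<close>

definition slice :: "('o, 'm) cat_struct \<Rightarrow> 'o \<Rightarrow> ('m, 'm \<times> 'm \<times> 'm) cat_struct" where
  "slice E A =
     \<lparr>Ob = {f \<in> Mor E. Cod E f = A},
      Mor = {(f, h, g). f \<in> Mor E \<and> Cod E f = A \<and> g \<in> Mor E \<and> Cod E g = A \<and>
                        h \<in> hom E (Dom E f) (Dom E g) \<and> g \<cdot>\<^bsub>E\<^esub> h = f},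
      Dom = (\<lambda>(f, h, g). f),
      Cod = (\<lambda>(f, h, g). g),
      Id = (\<lambda>f. (f, Id E (Dom E f), f)),
      Comp = (\<lambda>(g, k, l) (f, h, g'). (f, k \<cdot>\<^bsub>E\<^esub> h, l))\<rparr>"


section \<open>Notions inside a fixed category\<close>

context
  fixes E :: "('o, 'm) cat_struct" (structure)
begin

definition is_mono :: "'m \<Rightarrow> bool" where
  "is_mono m \<longleftrightarrow> m \<in> Mor E \<and>
     (\<forall>X. \<forall>u\<in>hom E X (Dom E m). \<forall>v\<in>hom E X (Dom E m). m \<cdot> u = m \<cdot> v \<longrightarrow> u = v)"

definition is_iso :: "'m \<Rightarrow> bool" where
  "is_iso f \<longleftrightarrow> f \<in> Mor E \<and>
     (\<exists>g\<in>hom E (Cod E f) (Dom E f). g \<cdot> f = Id E (Dom E f) \<and> f \<cdot> g = Id E (Cod E f))"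

text \<open>A subobject of \<open>A\<close>, represented by a mono into \<open>A\<close>, is \<open>A\<close> itself iff the mono is invertible.\<close>

definition is_cover :: "'m \<Rightarrow> bool" where
  "is_cover f \<longleftrightarrow> f \<in> Mor E \<and>
     (\<forall>m k. is_mono m \<and> Cod E m = Cod E f \<and> k \<in> hom E (Dom E f) (Dom E m) \<and> m \<cdot> k = f
        \<longrightarrow> is_iso m)"

text \<open>In all predicates on squares the arguments are, in this order, the top \<open>q : D \<rightarrow> B\<close>, the left side
  \<open>g : D \<rightarrow> C\<close>, the right side \<open>f : B \<rightarrow> A\<close> and the bottom \<open>p : C \<rightarrow> A\<close>.\<close>

definition comm_square :: "'m \<Rightarrow> 'm \<Rightarrow> 'm \<Rightarrow> 'm \<Rightarrow> bool" where
  "comm_square q g f p \<longleftrightarrow>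
     q \<in> Mor E \<and> g \<in> Mor E \<and> f \<in> Mor E \<and> p \<in> Mor E \<and>
     Dom E q = Dom E g \<and> Cod E q = Dom E f \<and> Cod E g = Dom E p \<and> Cod E f = Cod E p \<and>
     f \<cdot> q = p \<cdot> g"

definition is_pullback :: "'m \<Rightarrow> 'm \<Rightarrow> 'm \<Rightarrow> 'm \<Rightarrow> bool" where
  "is_pullback q g f p \<longleftrightarrow>
     comm_square q g f p \<and>
     (\<forall>x y. comm_square x y f p \<longrightarrow>
        (\<exists>!u. u \<in> hom E (Dom E x) (Dom E q) \<and> q \<cdot> u = x \<and> g \<cdot> u = y))"


subsection \<open>Regular, lextensive and locally cartesian closed categories\<close>

definition regular :: bool where
  "regular \<longleftrightarrow>
     has_finite_limits E \<and>
     (\<forall>f\<in>Mor E. \<exists>e m. is_cover e \<and> is_mono m \<and> Cod E e = Dom E m \<and> m \<cdot> e = f) \<and>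
     (\<forall>q g f p. is_pullback q g f p \<and> is_cover f \<longrightarrow> is_cover g)"

definition is_initial :: "'o \<Rightarrow> bool" where
  "is_initial Z \<longleftrightarrow> Z \<in> Ob E \<and> (\<forall>Y\<in>Ob E. \<exists>!h. h \<in> hom E Z Y)"

text \<open>\<open>S\<close> is the sum of \<open>X 0, \<dots>, X (n - 1)\<close> with coprojections \<open>i 0, \<dots>, i (n - 1)\<close>; the sum of no
  objects is an initial object.\<close>

definition is_sum :: "nat \<Rightarrow> (nat \<Rightarrow> 'o) \<Rightarrow> 'o \<Rightarrow> (nat \<Rightarrow> 'm) \<Rightarrow> bool" where
  "is_sum n X S i \<longleftrightarrow>
     S \<in> Ob E \<and> (\<forall>k<n. i k \<in> hom E (X k) S) \<and>
     (\<forall>Y y. Y \<in> Ob E \<and> (\<forall>k<n. y k \<in> hom E (X k) Y) \<longrightarrow>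
        (\<exists>!h. h \<in> hom E S Y \<and> (\<forall>k<n. h \<cdot> i k = y k)))"

definition has_finite_sums :: bool where
  "has_finite_sums \<longleftrightarrow>
     (\<forall>n X. (\<forall>k<n. X k \<in> Ob E) \<longrightarrow> (\<exists>S i. is_sum n X S i))"

definition sums_disjoint :: bool where
  "sums_disjoint \<longleftrightarrow>
     (\<forall>n X S i. is_sum n X S i \<longrightarrow>
        (\<forall>k<n. is_mono (i k)) \<and>
        (\<forall>k<n. \<forall>l<n. k \<noteq> l \<longrightarrow>
           (\<forall>q g. is_pullback q g (i k) (i l) \<longrightarrow> is_initial (Dom E q))))"

definition sums_stable :: bool where
  "sums_stable \<longleftrightarrow>
     (\<forall>n X S i f q j.
        is_sum n X S i \<and> f \<in> Mor E \<and> Cod E f = S \<and>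
        (\<forall>k<n. is_pullback (q k) (j k) (i k) f) \<longrightarrow>
        is_sum n (\<lambda>k. Dom E (j k)) (Dom E f) j)"

definition lextensive :: bool where
  "lextensive \<longleftrightarrow> has_finite_limits E \<and> has_finite_sums \<and> sums_disjoint \<and> sums_stable"

text \<open>A pullback functor along \<open>u\<close> amounts to a choice of pullback squares along \<open>u\<close>; \<open>q x\<close> below is the
  projection from the chosen pullback to the domain of \<open>x\<close>.\<close>

definition is_pullback_functor :: "'m \<Rightarrow> ('m \<Rightarrow> 'm) \<Rightarrow> ('m \<times> 'm \<times> 'm \<Rightarrow> 'm \<times> 'm \<times> 'm) \<Rightarrow> bool" where
  "is_pullback_functor u Fo Fm \<longleftrightarrow>
     is_functor (slice E (Cod E u)) (slice E (Dom E u)) Fo Fm \<and>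
     (\<exists>q. (\<forall>x\<in>Ob (slice E (Cod E u)). is_pullback (q x) (Fo x) x u) \<and>
          (\<forall>x h y. (x, h, y) \<in> Mor (slice E (Cod E u)) \<longrightarrow>
             (\<exists>k. Fm (x, h, y) = (Fo x, k, Fo y) \<and> q y \<cdot> k = h \<cdot> q x)))"

definition locally_cartesian_closed :: bool where
  "locally_cartesian_closed \<longleftrightarrow>
     has_finite_limits E \<and>
     (\<forall>u\<in>Mor E. \<forall>Fo Fm. is_pullback_functor u Fo Fm \<longrightarrow>
        has_right_adjoint (slice E (Cod E u)) (slice E (Dom E u)) Fo Fm)"


subsection \<open>Covering squares and strong collection squares\<close>

definition covering_square :: "'m \<Rightarrow> 'm \<Rightarrow> 'm \<Rightarrow> 'm \<Rightarrow> bool" where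
  "covering_square q g f p \<longleftrightarrow>
     comm_square q g f p \<and> is_cover p \<and>
     (\<exists>b c u. is_pullback b c f p \<and> u \<in> hom E (Dom E q) (Dom E b) \<and>
        b \<cdot> u = q \<and> c \<cdot> u = g \<and> is_cover u)"

definition covers :: "'m \<Rightarrow> 'm \<Rightarrow> bool" where
  "covers g f \<longleftrightarrow> (\<exists>q p. covering_square q g f p)"

text \<open>The Kripke-Joyal reading of the internal statement.  Here \<open>c : T \<rightarrow> C\<close>, \<open>x\<close> and \<open>y\<close> are the
  projections of \<open>T \<times>\<^sub>C D\<close> to \<open>T\<close> and \<open>D\<close>, \<open>e\<close> is a cover of \<open>T \<times>\<^sub>C D\<close>, \<open>t : T' \<rightarrow> T\<close>, and
  \<open>x', y'\<close> and \<open>x'', y''\<close> are the projections of \<open>T' \<times>\<^sub>C D\<close> formed along \<open>c'\<close> and along \<open>c \<cdot> t\<close>.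
  The arrow \<open>u\<close> is the canonical one identifying the latter object with the pullback of \<open>T \<times>\<^sub>C D\<close>
  along \<open>t\<close>, and \<open>e'\<close> is the pullback of \<open>e\<close>, as an arrow over \<open>T\<close>, along \<open>t\<close>.
  That \<open>h\<close> is an arrow over \<open>T' \<times> B\<close> means that it commutes with the projections to \<open>T'\<close> and \<open>B\<close>;
  \<open>k\<close> is its factorisation through \<open>e'\<close>.\<close>

definition strong_collection_square :: "'m \<Rightarrow> 'm \<Rightarrow> 'm \<Rightarrow> 'm \<Rightarrow> bool" where
  "strong_collection_square q g f p \<longleftrightarrow>
     comm_square q g f p \<and>
     (\<forall>c x y e.
        is_pullback y x g c \<and> is_cover e \<and> Cod E e = Dom E x \<longrightarrow>
        (\<exists>t c' x' y' x'' y'' u a b e' h k.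
           is_cover t \<and> Cod E t = Dom E c \<and>
           c' \<in> hom E (Dom E t) (Dom E p) \<and> p \<cdot> c' = p \<cdot> (c \<cdot> t) \<and>
           is_pullback y' x' g c' \<and> is_pullback y'' x'' g (c \<cdot> t) \<and>
           u \<in> hom E (Dom E x'') (Dom E x) \<and> x \<cdot> u = t \<cdot> x'' \<and> y \<cdot> u = y'' \<and>
           is_pullback b a (x \<cdot> e) t \<and>
           e' \<in> hom E (Dom E a) (Dom E x'') \<and> x'' \<cdot> e' = a \<and> u \<cdot> e' = e \<cdot> b \<and>
           is_cover h \<and> h \<in> hom E (Dom E x') (Dom E x'') \<and>
           x'' \<cdot> h = x' \<and> (q \<cdot> y'') \<cdot> h = q \<cdot> y' \<and>
           k \<in> hom E (Dom E x') (Dom E a) \<and> h = e' \<cdot> k))"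

definition SAMC :: bool where
  "SAMC \<longleftrightarrow>
     (\<forall>f\<in>Mor E. \<exists>q g p. covering_square q g f p \<and> strong_collection_square q g f p)"


subsection \<open>Classes of small maps\<close>

definition small_class :: "'m set \<Rightarrow> bool" where
  "small_class S \<longleftrightarrow>
     S \<subseteq> Mor E \<and>
     (\<forall>q g f p. is_pullback q g f p \<and> f \<in> S \<longrightarrow> g \<in> S) \<and>
     (\<forall>g f. covers g f \<and> g \<in> S \<longrightarrow> f \<in> S) \<and>
     (\<forall>p f. is_cover p \<and> f \<in> S \<and> Cod E p = Dom E f \<longrightarrow>
        (\<exists>q g b k. covering_square q g f b \<and> g \<in> S \<and>
           k \<in> hom E (Dom E q) (Dom E p) \<and> q = p \<cdot> k))"

definition representation :: "'m set \<Rightarrow> 'm \<Rightarrow> bool" where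
  "representation S \<pi> \<longleftrightarrow>
     \<pi> \<in> S \<and> (\<forall>f\<in>S. \<exists>q g p. is_pullback q g \<pi> p \<and> covers g f)"

definition representable :: "'m set \<Rightarrow> bool" where
  "representable S \<longleftrightarrow> (\<exists>\<pi>. representation S \<pi>)"

definition RP :: bool where
  "RP \<longleftrightarrow> (\<forall>f\<in>Mor E. \<exists>S. small_class S \<and> representable S \<and> f \<in> S)"

end

end

theory Submission
  imports Defs
begin

text \<open>Given a covering strong collection square with right side \<open>f\<close> and left side \<open>g\<close>, the maps covered by
  a pullback of \<open>g\<close> form a class of small maps represented by \<open>g\<close>: strong collection refines a cover of a
  pullback of \<open>g\<close> to another pullback of \<open>g\<close>, which is (S3).

  Conversely, let \<open>f : B \<rightarrow> A\<close> lie in a class represented by \<open>\<pi> : V \<rightarrow> U\<close>.  Let \<open>C\<close> be the object of triples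
  \<open>(a, w, \<phi>)\<close> with \<open>\<phi>\<close> a cover from the fibre \<open>V\<^sub>w\<close> to the fibre \<open>B\<^sub>a\<close>, let \<open>g : D \<rightarrow> C\<close> have fibre \<open>V\<^sub>w\<close> over
  \<open>(a, w, \<phi>)\<close>, and let \<open>D \<rightarrow> B\<close> be evaluation.  Representability makes \<open>C \<rightarrow> A\<close> a cover.  For a cover \<open>e\<close>
  of \<open>V\<^sub>w\<close>, (S3) and representability give, locally, a cover \<open>V\<^bsub>w'\<^esub> \<rightarrow> V\<^sub>w\<close> that factors through \<open>e\<close>; its
  composite with \<open>\<phi>\<close> is the element \<open>c'\<close> demanded by strong collection.\<close>

section \<open>Composition and pullbacks\<close>

context category
begin

lemma Comp_Mor [simp]: "f \<in> Mor E \<Longrightarrow> g \<in> Mor E \<Longrightarrow> Cod E f = Dom E g \<Longrightarrow> g \<cdot> f \<in> Mor E"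
  and Dom_Comp [simp]: "f \<in> Mor E \<Longrightarrow> g \<in> Mor E \<Longrightarrow> Cod E f = Dom E g \<Longrightarrow> Dom E (g \<cdot> f) = Dom E f"
  and Cod_Comp [simp]: "f \<in> Mor E \<Longrightarrow> g \<in> Mor E \<Longrightarrow> Cod E f = Dom E g \<Longrightarrow> Cod E (g \<cdot> f) = Cod E g"
  using Comp_hom[of f "Dom E f" "Cod E f" g "Cod E g"] by (auto simp: hom_def)

lemma assoc [simp]:
  "f \<in> Mor E \<Longrightarrow> g \<in> Mor E \<Longrightarrow> h \<in> Mor E \<Longrightarrow> Cod E f = Dom E g \<Longrightarrow> Cod E g = Dom E h
    \<Longrightarrow> (h \<cdot> g) \<cdot> f = h \<cdot> (g \<cdot> f)"
  using Comp_assoc[of f "Dom E f" "Cod E f" g "Cod E g" h "Cod E h"] unfolding hom_def by simp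

lemma Id_simps [simp]:
  "A \<in> Ob E \<Longrightarrow> Id E A \<in> Mor E"
  "A \<in> Ob E \<Longrightarrow> Dom E (Id E A) = A"
  "A \<in> Ob E \<Longrightarrow> Cod E (Id E A) = A"
  using Id_hom[of A] by (auto simp: hom_def)

lemma Comp_Id_right [simp]: "f \<in> Mor E \<Longrightarrow> Dom E f = A \<Longrightarrow> f \<cdot> Id E A = f"
  and Comp_Id_left [simp]: "f \<in> Mor E \<Longrightarrow> Cod E f = A \<Longrightarrow> Id E A \<cdot> f = f"
  using Comp_Id Id_Comp by (auto simp: hom_def)

lemma hom_Ob: "f \<in> hom E A B \<Longrightarrow> A \<in> Ob E \<and> B \<in> Ob E"
  using Dom_Ob Cod_Ob by (auto simp: hom_def)

text \<open>The simp rule \<open>assoc\<close> brackets composites to the right, so an equation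
  about \<open>g \<cdot> f\<close> no longer matches inside \<open>g \<cdot> (f \<cdot> x)\<close>.
  Used as \<open>eq[THEN reassoc]\<close>, this yields the form that does.\<close>

lemma reassoc:
  assumes "g \<cdot> f = h" "f \<in> Mor E" "g \<in> Mor E" "Cod E f = Dom E g" "x \<in> Mor E" "Cod E x = Dom E f"
  shows "g \<cdot> (f \<cdot> x) = h \<cdot> x"
  using assms assoc by force

lemma pullbackE:
  assumes "is_pullback E q g f p"
  obtains D B C A where "q \<in> hom E D B" "g \<in> hom E D C" "f \<in> hom E B A" "p \<in> hom E C A"
    "f \<cdot> q = p \<cdot> g"
  using assms by (auto simp: is_pullback_def comm_square_def hom_def)

lemma pullback_fac:
  assumes "is_pullback E q g f p" "x \<in> hom E T (Dom E f)" "y \<in> hom E T (Dom E p)" "f \<cdot> x = p \<cdot> y"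
  obtains u where "u \<in> hom E T (Dom E q)" "q \<cdot> u = x" "g \<cdot> u = y"
proof -
  have "comm_square E x y f p"
    using assms by (auto simp: is_pullback_def comm_square_def hom_def)
  then obtain u where "u \<in> hom E (Dom E x) (Dom E q)" "q \<cdot> u = x" "g \<cdot> u = y"
    using assms(1) unfolding is_pullback_def by blast
  moreover have "Dom E x = T" using assms(2) by (simp add: hom_def)
  ultimately show thesis using that by simp
qed

lemma pullback_eq:
  assumes "is_pullback E q g f p" "u \<in> hom E T (Dom E q)" "v \<in> hom E T (Dom E q)"
    "q \<cdot> u = q \<cdot> v" "g \<cdot> u = g \<cdot> v"
  shows "u = v"
proof -
  have sq: "q \<in> Mor E" "g \<in> Mor E" "f \<in> Mor E" "p \<in> Mor E"
    "Dom E q = Dom E g" "Cod E q = Dom E f" "Cod E g = Dom E p" "Cod E f = Cod E p"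
    "f \<cdot> q = p \<cdot> g"
    using assms by (auto simp: is_pullback_def comm_square_def)
  then have "comm_square E (q \<cdot> u) (g \<cdot> u) f p" "Dom E (q \<cdot> u) = T"
    using assms(2) reassoc[OF sq(9)] by (auto simp: comm_square_def hom_def)
  then have "\<exists>!w. w \<in> hom E T (Dom E q) \<and> q \<cdot> w = q \<cdot> u \<and> g \<cdot> w = g \<cdot> u"
    using assms(1) unfolding is_pullback_def by blast
  then show ?thesis using assms by metis
qed

lemma pullbackI:
  assumes "q \<in> hom E D B" "g \<in> hom E D C" "f \<in> hom E B A" "p \<in> hom E C A" "f \<cdot> q = p \<cdot> g"
    and "\<And>T x y. x \<in> hom E T B \<Longrightarrow> y \<in> hom E T C \<Longrightarrow> f \<cdot> x = p \<cdot> y \<Longrightarrow>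
      \<exists>u. u \<in> hom E T D \<and> q \<cdot> u = x \<and> g \<cdot> u = y"
    and "\<And>T u v. u \<in> hom E T D \<Longrightarrow> v \<in> hom E T D \<Longrightarrow> q \<cdot> u = q \<cdot> v \<Longrightarrow> g \<cdot> u = g \<cdot> v \<Longrightarrow> u = v"
  shows "is_pullback E q g f p"
  unfolding is_pullback_def
proof (intro conjI allI impI)
  show "comm_square E q g f p" using assms(1-5) by (auto simp: comm_square_def hom_def)
  fix x y assume "comm_square E x y f p"
  then have "x \<in> hom E (Dom E x) B" "y \<in> hom E (Dom E x) C" "f \<cdot> x = p \<cdot> y"
    using assms(1-5) by (auto simp: comm_square_def hom_def)
  from assms(6)[OF this] obtain u where "u \<in> hom E (Dom E x) D" "q \<cdot> u = x" "g \<cdot> u = y" by blast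
  moreover have "Dom E q = D" using assms(1) by (auto simp: hom_def)
  ultimately show "\<exists>!u. u \<in> hom E (Dom E x) (Dom E q) \<and> q \<cdot> u = x \<and> g \<cdot> u = y"
    using assms(7) by metis
qed

lemma pullback_flip:
  assumes "is_pullback E q g f p"
  shows "is_pullback E g q p f"
proof -
  obtain D B C A where ty: "q \<in> hom E D B" "g \<in> hom E D C" "f \<in> hom E B A" "p \<in> hom E C A"
    "f \<cdot> q = p \<cdot> g"
    using assms by (rule pullbackE)
  then have d: "Dom E f = B" "Dom E p = C" "Dom E q = D" by (auto simp: hom_def)
  show ?thesis
  proof (rule pullbackI[OF ty(2,1,4,3) ty(5)[symmetric]])
    fix T x y assume "x \<in> hom E T C" "y \<in> hom E T B" "p \<cdot> x = f \<cdot> y"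
    then show "\<exists>u. u \<in> hom E T D \<and> g \<cdot> u = x \<and> q \<cdot> u = y"
      using pullback_fac[OF assms, of y T x thesis for thesis] unfolding d by metis
  next
    fix T u v assume "u \<in> hom E T D" "v \<in> hom E T D" "g \<cdot> u = g \<cdot> v" "q \<cdot> u = q \<cdot> v"
    then show "u = v" using pullback_eq[OF assms, of u T v] unfolding d by blast
  qed
qed

text \<open>A compatible pair out of \<open>T\<close> is lifted first to the right-hand pullback
  \<open>D\<close> and from there to the left-hand one.\<close>

lemma pullback_paste:
  assumes r: "is_pullback E q g f p" and l: "is_pullback E q' g' g p'"
  shows "is_pullback E (q \<cdot> q') g' f (p \<cdot> p')"
proof -
  obtain D B C A where ty: "q \<in> hom E D B" "g \<in> hom E D C" "f \<in> hom E B A" "p \<in> hom E C A"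
    and eq: "f \<cdot> q = p \<cdot> g"
    using r by (rule pullbackE)
  from l obtain D' C' where ty': "q' \<in> hom E D' D" "g' \<in> hom E D' C'" "p' \<in> hom E C' C"
    and eq': "g \<cdot> q' = p' \<cdot> g'"
    using ty(2) by (elim pullbackE) (auto simp: hom_def)
  note S = hom_def eq eq' eq[THEN reassoc] eq'[THEN reassoc]
  show ?thesis
  proof (rule pullbackI)
    show "q \<cdot> q' \<in> hom E D' B" "g' \<in> hom E D' C'" "f \<in> hom E B A" "p \<cdot> p' \<in> hom E C' A"
      "f \<cdot> (q \<cdot> q') = p \<cdot> p' \<cdot> g'" using ty ty' by (simp_all add: S)
  next
    fix T x y assume xy: "x \<in> hom E T B" "y \<in> hom E T C'" "f \<cdot> x = p \<cdot> p' \<cdot> y"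
    obtain u where u: "u \<in> hom E T D" "q \<cdot> u = x" "g \<cdot> u = p' \<cdot> y"
      using pullback_fac[OF r, of x T "p' \<cdot> y"] xy ty ty' by (auto simp: S)
    obtain v where v: "v \<in> hom E T D'" "q' \<cdot> v = u" "g' \<cdot> v = y"
      using pullback_fac[OF l, of u T "y"] u xy ty ty' by (auto simp: S)
    then show "\<exists>u. u \<in> hom E T D' \<and> q \<cdot> q' \<cdot> u = x \<and> g' \<cdot> u = y"
      using u ty ty' by (intro exI[of _ v]) (auto simp: S)
  next
    fix T u v assume uv: "u \<in> hom E T D'" "v \<in> hom E T D'" "q \<cdot> q' \<cdot> u = q \<cdot> q' \<cdot> v"
      "g' \<cdot> u = g' \<cdot> v"
    have "q' \<cdot> u = q' \<cdot> v"
      using pullback_eq[OF r, of "q' \<cdot> u" T "q' \<cdot> v"] uv ty ty' by (auto simp: S)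
    then show "u = v" using pullback_eq[OF l, of u T v] uv ty ty' by (auto simp: S)
  qed
qed

text \<open>The outer rectangle supplies the factorisation \<open>u\<close>, and the right-hand
  square shows that \<open>q' \<cdot> u\<close> is the prescribed arrow. The top of the rectangle is
  a separate variable \<open>b\<close>, so that any expression equal to \<open>q \<cdot> q'\<close>
  fits.\<close>

lemma pullback_cancel:
  assumes r: "is_pullback E q g f p" and o: "is_pullback E b g' f (p \<cdot> p')"
    and ty': "q' \<in> hom E D' D" "g \<in> hom E D C" "p' \<in> hom E C' C"
    and eq': "g \<cdot> q' = p' \<cdot> g'" and b: "q \<cdot> q' = b"
  shows "is_pullback E q' g' g p'"
proof -
  obtain B A where ty: "q \<in> hom E D B" "g \<in> hom E D C" "f \<in> hom E B A" "p \<in> hom E C A"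
    and eq: "f \<cdot> q = p \<cdot> g"
    using r ty' by (elim pullbackE) (auto simp: hom_def)
  have b_hom: "b \<in> hom E D' B" using ty ty' by (simp add: b[symmetric] hom_def)
  have "g' \<in> Mor E" "Dom E g' = Dom E b" "Cod E g' = Dom E (p \<cdot> p')"
    using o by (simp_all add: is_pullback_def comm_square_def)
  then have ty'': "b \<in> hom E D' B" "g' \<in> hom E D' C'"
    using b_hom ty ty' by (simp_all add: hom_def)
  note S = hom_def eq eq' eq[THEN reassoc] eq'[THEN reassoc] b[THEN reassoc]
  show ?thesis
  proof (rule pullbackI[OF ty'(1) ty''(2) ty(2) ty'(3) eq'])
    fix T x y assume xy: "x \<in> hom E T D" "y \<in> hom E T C'" "g \<cdot> x = p' \<cdot> y"
    obtain u where u: "u \<in> hom E T D'" "b \<cdot> u = q \<cdot> x" "g' \<cdot> u = y"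
      using pullback_fac[OF o, of "q \<cdot> x" T "y"] xy ty ty' ty'' by (auto simp: S)
    have "q' \<cdot> u = x"
      using pullback_eq[OF r, of "q' \<cdot> u" T x] u xy ty ty' ty'' by (auto simp: S)
    then show "\<exists>u. u \<in> hom E T D' \<and> q' \<cdot> u = x \<and> g' \<cdot> u = y" using u by blast
  next
    fix T u v assume uv: "u \<in> hom E T D'" "v \<in> hom E T D'" "q' \<cdot> u = q' \<cdot> v"
      "g' \<cdot> u = g' \<cdot> v"
    have "b \<cdot> u = b \<cdot> v" using uv ty ty' ty'' unfolding b[symmetric] by (auto simp: hom_def)
    then show "u = v" using pullback_eq[OF o, of u T v] uv ty ty' ty'' by (auto simp: S)
  qed
qed

lemma pullback_Id:
  assumes "f \<in> hom E B A"
  shows "is_pullback E (Id E B) f f (Id E A)"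
proof -
  have o: "A \<in> Ob E" "B \<in> Ob E" using assms hom_Ob by auto
  show ?thesis
  proof (rule pullbackI[of _ B B _ A])
    fix T x y assume "x \<in> hom E T B" "y \<in> hom E T A" "f \<cdot> x = Id E A \<cdot> y"
    then show "\<exists>u. u \<in> hom E T B \<and> Id E B \<cdot> u = x \<and> f \<cdot> u = y" by (intro exI[of _ x]) (simp add: hom_def)
  qed (use assms o in \<open>simp_all add: hom_def\<close>)
qed

end

section \<open>Finite limits and covers\<close>

definition empty_cat :: "(nat, nat) cat_struct" where
  "empty_cat = \<lparr>Ob = {}, Mor = {}, Dom = id, Cod = id, Id = id, Comp = (\<lambda>g f. f)\<rparr>"

text \<open>The objects are \<open>0, 1, 2\<close>, with identities of the same names; the other arrows are
  \<open>3 : 0 \<rightarrow> 2\<close> and \<open>4 : 1 \<rightarrow> 2\<close>.\<close>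

definition cospan_cat :: "(nat, nat) cat_struct" where
  "cospan_cat = \<lparr>Ob = {0, 1, 2}, Mor = {0, 1, 2, 3, 4},
     Dom = (\<lambda>m. if m = 3 then 0 else if m = 4 then 1 else m),
     Cod = (\<lambda>m. if m = 3 \<or> m = 4 then 2 else m),
     Id = id, Comp = (\<lambda>g f. if f = 3 \<or> f = 4 then f else g)\<rparr>"

lemma category_empty_cat: "category empty_cat"
  by unfold_locales (auto simp: empty_cat_def hom_def)

lemma category_cospan_cat: "category cospan_cat"
  by unfold_locales (auto simp: cospan_cat_def hom_def)

lemma finite_empty_cat: "finite (Ob empty_cat)" "finite (Mor empty_cat)"
  by (auto simp: empty_cat_def)

lemma finite_cospan_cat: "finite (Ob cospan_cat)" "finite (Mor cospan_cat)"
  by (auto simp: cospan_cat_def)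

locale regular_category = category +
  assumes regular: "regular E"
begin

lemma finite_limits: "has_finite_limits E"
  using regular by (simp add: regular_def)

lemma terminal_exists:
  obtains I where "I \<in> Ob E" "\<forall>A\<in>Ob E. \<exists>!h. h \<in> hom E A I"
proof -
  \<comment> \<open>On the empty shape any two functions form a functor and a cone is just an
    object, so a limit is a terminal object.\<close>
  have "is_functor empty_cat E undefined undefined"
    using category_axioms category_empty_cat by (auto simp: is_functor_def empty_cat_def hom_def)
  then obtain I l where "is_limit empty_cat E undefined undefined I l"
    using finite_limits finite_empty_cat unfolding has_finite_limits_def by blast
  then show thesis using that[of I]
    by (auto simp: is_limit_def is_cone_def empty_cat_def)
qed

lemma pullback_exists:
  assumes f: "f \<in> hom E B A" and p: "p \<in> hom E C A"
  obtains q g D where "is_pullback E q g f p" "q \<in> hom E D B" "g \<in> hom E D C"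
proof -
  \<comment> \<open>The cospan as a diagram: arrow 3 goes to \<open>f\<close>, arrow 4 to
    \<open>p\<close>, and the arrows 0, 1, 2 to identities.\<close>
  define Fo where "Fo = (\<lambda>i::nat. if i = 0 then B else if i = 1 then C else A)"
  define Fm where "Fm = (\<lambda>i::nat. if i = 3 then f else if i = 4 then p else Id E (Fo i))"
  have o: "A \<in> Ob E" "B \<in> Ob E" "C \<in> Ob E" using f p hom_Ob by auto
  have "is_functor cospan_cat E Fo Fm"
    using category_axioms category_cospan_cat f p o
    by (auto simp: is_functor_def cospan_cat_def Fo_def Fm_def hom_def)
  then obtain D l where lim: "is_limit cospan_cat E Fo Fm D l"
    using finite_limits finite_cospan_cat unfolding has_finite_limits_def by blast
  have cone: "is_cone cospan_cat E Fo Fm M m \<longleftrightarrow> M \<in> Ob E \<and>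
      m 0 \<in> hom E M B \<and> m 1 \<in> hom E M C \<and> m 2 \<in> hom E M A \<and> f \<cdot> m 0 = m 2 \<and> p \<cdot> m 1 = m 2" for M m
    using o by (auto simp: is_cone_def cospan_cat_def Fo_def Fm_def hom_def)
  have l: "l 0 \<in> hom E D B" "l 1 \<in> hom E D C" "l 2 \<in> hom E D A" "f \<cdot> l 0 = l 2" "p \<cdot> l 1 = l 2"
    using lim cone by (auto simp: is_limit_def)
  have U: "\<exists>!k. k \<in> hom E T D \<and> l 0 \<cdot> k = x \<and> l 1 \<cdot> k = y"
    if xy: "x \<in> hom E T B" "y \<in> hom E T C" "f \<cdot> x = p \<cdot> y" for T x y
  proof -
    define m where "m = (\<lambda>i::nat. if i = 0 then x else if i = 1 then y else f \<cdot> x)"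
    have "is_cone cospan_cat E Fo Fm T m"
      unfolding cone using xy f p hom_Ob[OF xy(1)] by (auto simp: m_def hom_def)
    then have "\<exists>!k. k \<in> hom E T D \<and> (\<forall>i\<in>{0, 1, 2}. l i \<cdot> k = m i)"
      using lim by (simp add: is_limit_def cospan_cat_def)
    \<comment> \<open>A cone has a third leg, into \<open>A\<close>. Its equation follows from the
      one for the leg into \<open>B\<close>, so the two projections alone determine
      \<open>k\<close>.\<close>
    moreover have "l 2 \<cdot> k = f \<cdot> x" if "k \<in> hom E T D" "l 0 \<cdot> k = x" for k
      using that l f unfolding l(4)[symmetric] by (simp add: hom_def)
    ultimately show ?thesis by (auto simp: m_def)
  qed
  have "is_pullback E (l 0) (l 1) f p"
  proof (rule pullbackI[OF l(1,2) f p])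
    show "f \<cdot> l 0 = p \<cdot> l 1" using l by simp
  next
    fix T x y assume "x \<in> hom E T B" "y \<in> hom E T C" "f \<cdot> x = p \<cdot> y"
    then show "\<exists>u. u \<in> hom E T D \<and> l 0 \<cdot> u = x \<and> l 1 \<cdot> u = y" using U by blast
  next
    fix T u v assume uv: "u \<in> hom E T D" "v \<in> hom E T D" "l 0 \<cdot> u = l 0 \<cdot> v" "l 1 \<cdot> u = l 1 \<cdot> v"
    have "f \<cdot> (l 0 \<cdot> u) = p \<cdot> (l 1 \<cdot> u)"
      using uv(1) l f p l(4)[THEN reassoc, of u] l(5)[THEN reassoc, of u] by (simp add: hom_def)
    moreover have "l 0 \<cdot> u \<in> hom E T B" "l 1 \<cdot> u \<in> hom E T C"
      using uv(1) l by (simp_all add: hom_def)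
    ultimately show "u = v" using U uv by metis
  qed
  then show thesis using that l by blast
qed

text \<open>The product is the pullback over a terminal object, where every square commutes.\<close>

lemma product_exists:
  assumes "A \<in> Ob E" "B \<in> Ob E"
  obtains P p q where "p \<in> hom E P A" "q \<in> hom E P B"
    "\<And>T x y. x \<in> hom E T A \<Longrightarrow> y \<in> hom E T B \<Longrightarrow> \<exists>u. u \<in> hom E T P \<and> p \<cdot> u = x \<and> q \<cdot> u = y"
    "\<And>T u v. u \<in> hom E T P \<Longrightarrow> v \<in> hom E T P \<Longrightarrow> p \<cdot> u = p \<cdot> v \<Longrightarrow> q \<cdot> u = q \<cdot> v \<Longrightarrow> u = v"
proof -
  obtain I where I: "I \<in> Ob E" "\<forall>A\<in>Ob E. \<exists>!h. h \<in> hom E A I" by (rule terminal_exists)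
  obtain a b where ab: "a \<in> hom E A I" "b \<in> hom E B I" using I(2) assms by blast
  obtain p q P where pb: "is_pullback E p q a b" and pq: "p \<in> hom E P A" "q \<in> hom E P B"
    using pullback_exists[OF ab] by metis
  show thesis
  proof (rule that[OF pq])
    fix T x y assume xy: "x \<in> hom E T A" "y \<in> hom E T B"
    have "a \<cdot> x \<in> hom E T I" "b \<cdot> y \<in> hom E T I" using xy ab Comp_hom by auto
    then have "a \<cdot> x = b \<cdot> y" using I(2) hom_Ob[OF xy(1)] by blast
    then show "\<exists>u. u \<in> hom E T P \<and> p \<cdot> u = x \<and> q \<cdot> u = y"
      using pullback_fac[OF pb, of x T y] xy ab pq by (auto simp: hom_def)
  next
    fix T u v assume "u \<in> hom E T P" "v \<in> hom E T P" "p \<cdot> u = p \<cdot> v" "q \<cdot> u = q \<cdot> v"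
    then show "u = v" using pullback_eq[OF pb, of u T v] pq by (auto simp: hom_def)
  qed
qed

section \<open>Monos, covers and images\<close>

lemma monoD: "is_mono E m \<Longrightarrow> m \<in> hom E I A \<Longrightarrow> u \<in> hom E X I \<Longrightarrow> v \<in> hom E X I \<Longrightarrow> m \<cdot> u = m \<cdot> v \<Longrightarrow> u = v"
  by (auto simp: is_mono_def hom_def)

lemma mono_pullback:
  assumes pb: "is_pullback E q g f p" and m: "is_mono E f"
  shows "is_mono E g"
proof -
  obtain D B C A where ty: "q \<in> hom E D B" "g \<in> hom E D C" "f \<in> hom E B A" "p \<in> hom E C A"
    and eq: "f \<cdot> q = p \<cdot> g" using pb by (rule pullbackE)
  note S = hom_def eq eq[THEN reassoc]
  have "u = v" if uv: "u \<in> hom E X D" "v \<in> hom E X D" "g \<cdot> u = g \<cdot> v" for X u v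
  proof -
    have "f \<cdot> (q \<cdot> u) = f \<cdot> (q \<cdot> v)" using uv ty by (simp add: S)
    then have "q \<cdot> u = q \<cdot> v"
      using monoD[OF m ty(3), of "q \<cdot> u" X "q \<cdot> v"] uv ty by (simp add: S)
    then show "u = v" using pullback_eq[OF pb, of u X v] uv ty by (simp add: S)
  qed
  then show ?thesis using ty by (auto simp: is_mono_def hom_def)
qed

lemma coverI:
  assumes "f \<in> hom E B A"
    and "\<And>m k I. is_mono E m \<Longrightarrow> m \<in> hom E I A \<Longrightarrow> k \<in> hom E B I \<Longrightarrow> m \<cdot> k = f \<Longrightarrow> is_iso E m"
  shows "is_cover E f"
  using assms by (auto simp: is_cover_def hom_def is_mono_def)

lemma coverD:
  assumes "is_cover E f" "f \<in> hom E B A" "is_mono E m" "m \<in> hom E I A" "k \<in> hom E B I" "m \<cdot> k = f"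
  obtains n where "n \<in> hom E A I" "m \<cdot> n = Id E A" "n \<cdot> m = Id E I"
proof -
  have "is_iso E m" using assms unfolding is_cover_def hom_def by auto
  then show thesis using that assms(4) by (auto simp: is_iso_def hom_def)
qed

lemma isoI:
  assumes "m \<in> hom E I A" "n \<in> hom E A I" "m \<cdot> n = Id E A" "n \<cdot> m = Id E I"
  shows "is_iso E m"
  using assms by (auto simp: is_iso_def hom_def)

text \<open>Since \<open>m \<cdot> (n \<cdot> m) = m\<close>, monicity cancels \<open>m\<close> on
  the left.\<close>

lemma iso_of_mono_section:
  assumes m: "is_mono E m" "m \<in> hom E I A" and n: "n \<in> hom E A I" "m \<cdot> n = Id E A"
  shows "is_iso E m"
proof (rule isoI[OF m(2) n])
  have o: "I \<in> Ob E" "A \<in> Ob E" using m hom_Ob by auto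
  show "n \<cdot> m = Id E I"
    using monoD[OF m, of "n \<cdot> m" I "Id E I"] m n o n(2)[THEN reassoc, of m] by (auto simp: hom_def)
qed

text \<open>Covers are orthogonal to monos: pull \<open>m\<close> back along \<open>b\<close>; the cover factors through the result.\<close>

lemma cover_mono_lift:
  assumes e: "is_cover E e" "e \<in> hom E X Y" and m: "is_mono E m" "m \<in> hom E I Z"
    and ab: "a \<in> hom E X I" "b \<in> hom E Y Z" and eq: "m \<cdot> a = b \<cdot> e"
  obtains d where "d \<in> hom E Y I" "m \<cdot> d = b"
proof -
  obtain q g D where pb: "is_pullback E q g m b" and qg: "q \<in> hom E D I" "g \<in> hom E D Y"
    using pullback_exists[OF m(2) ab(2)] by metis
  have sq: "m \<cdot> q = b \<cdot> g" using pb by (simp add: is_pullback_def comm_square_def)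
  obtain k where k: "k \<in> hom E X D" "q \<cdot> k = a" "g \<cdot> k = e"
    using pullback_fac[OF pb, of a X e] e m ab eq qg by (auto simp: hom_def)
  obtain n where n: "n \<in> hom E Y D" "g \<cdot> n = Id E Y"
    using coverD[OF e mono_pullback[OF pb m(1)] qg(2) k(1,3)] by metis
  have "m \<cdot> (q \<cdot> n) = b"
    using sq[THEN reassoc, of n] n qg m ab by (simp add: hom_def)
  then show thesis using that[of "q \<cdot> n"] qg n by (simp add: hom_def)
qed

text \<open>If \<open>g \<cdot> f\<close> factors through a mono \<open>m\<close>, orthogonality of
  \<open>f\<close> to \<open>m\<close> already factors \<open>g\<close> through
  \<open>m\<close>.\<close>

lemma cover_comp:
  assumes f: "is_cover E f" "f \<in> hom E A B" and g: "is_cover E g" "g \<in> hom E B C"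
  shows "is_cover E (g \<cdot> f)"
proof (rule coverI)
  show "g \<cdot> f \<in> hom E A C" using f g Comp_hom by blast
  fix m k I assume m: "is_mono E m" "m \<in> hom E I C" and k: "k \<in> hom E A I" "m \<cdot> k = g \<cdot> f"
  obtain d where d: "d \<in> hom E B I" "m \<cdot> d = g"
    using cover_mono_lift[OF f m k(1) g(2) k(2)] by metis
  obtain n where "n \<in> hom E C I" "m \<cdot> n = Id E C" "n \<cdot> m = Id E I"
    using coverD[OF g m d] by metis
  then show "is_iso E m" using isoI m by blast
qed

lemma cover_comp_right:
  assumes gf: "is_cover E (g \<cdot> f)" and f: "f \<in> hom E A B" and g: "g \<in> hom E B C"
  shows "is_cover E g"
proof (rule coverI[OF g])
  fix m k I assume m: "is_mono E m" "m \<in> hom E I C" and k: "k \<in> hom E B I" "m \<cdot> k = g"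
  have "g \<cdot> f \<in> hom E A C" "k \<cdot> f \<in> hom E A I" using f g k Comp_hom by blast+
  moreover have "m \<cdot> (k \<cdot> f) = g \<cdot> f" using k(2)[THEN reassoc, of f] f g k m by (simp add: hom_def)
  ultimately obtain n where "n \<in> hom E C I" "m \<cdot> n = Id E C" "n \<cdot> m = Id E I"
    using coverD[OF gf _ m] by metis
  then show "is_iso E m" using isoI m by blast
qed

lemma cover_Id:
  assumes "A \<in> Ob E"
  shows "is_cover E (Id E A)"
  using assms by (intro coverI[of _ A A] iso_of_mono_section) (auto simp: hom_def)

lemma cover_pullback: "is_pullback E q g f p \<Longrightarrow> is_cover E f \<Longrightarrow> is_cover E g"
  using regular unfolding regular_def by blast

lemma cover_mono_factorisation:
  assumes "f \<in> hom E B A"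
  obtains e m I where "is_cover E e" "is_mono E m" "e \<in> hom E B I" "m \<in> hom E I A" "m \<cdot> e = f"
proof -
  obtain e m where em: "is_cover E e" "is_mono E m" "Cod E e = Dom E m" "m \<cdot> e = f"
    using regular assms unfolding regular_def hom_def by blast
  then have "e \<in> Mor E" "m \<in> Mor E" by (auto simp: is_cover_def is_mono_def)
  then have "e \<in> hom E B (Dom E m)" "m \<in> hom E (Dom E m) A"
    using em assms by (auto simp: hom_def)
  then show thesis using that em by blast
qed

section \<open>Covering squares\<close>

text \<open>A covering square without the condition on its bottom: fibrewise, \<open>q\<close> is a
  cover from the fibres of \<open>g\<close> to those of \<open>f\<close>. Maps into the object of
  fibre covers correspond to such squares over an arbitrary base.\<close>

definition quasi_pullback :: "'b \<Rightarrow> 'b \<Rightarrow> 'b \<Rightarrow> 'b \<Rightarrow> bool" where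
  "quasi_pullback q g f p \<longleftrightarrow> comm_square E q g f p \<and>
     (\<exists>b c u. is_pullback E b c f p \<and> u \<in> hom E (Dom E q) (Dom E b) \<and>
        b \<cdot> u = q \<and> c \<cdot> u = g \<and> is_cover E u)"

lemma covering_square_iff: "covering_square E q g f p \<longleftrightarrow> is_cover E p \<and> quasi_pullback q g f p"
  by (auto simp: covering_square_def quasi_pullback_def)

lemma quasi_pullbackE:
  assumes "quasi_pullback q g f p"
  obtains D B C A where "q \<in> hom E D B" "g \<in> hom E D C" "f \<in> hom E B A" "p \<in> hom E C A"
    "f \<cdot> q = p \<cdot> g"
  using assms by (auto simp: quasi_pullback_def comm_square_def hom_def)

lemma quasi_pullbackI:
  assumes pb: "is_pullback E b c f p" and u: "is_cover E u" "u \<in> hom E D (Dom E b)"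
  shows "quasi_pullback (b \<cdot> u) (c \<cdot> u) f p"
proof -
  obtain P B C A where ty: "b \<in> hom E P B" "c \<in> hom E P C" "f \<in> hom E B A" "p \<in> hom E C A"
    and eq: "f \<cdot> b = p \<cdot> c" using pb by (rule pullbackE)
  have "comm_square E (b \<cdot> u) (c \<cdot> u) f p"
    using ty u eq[THEN reassoc, of u] by (auto simp: comm_square_def hom_def)
  moreover have "u \<in> hom E (Dom E (b \<cdot> u)) (Dom E b)" using ty u by (auto simp: hom_def)
  ultimately show ?thesis unfolding quasi_pullback_def using pb u by blast
qed

text \<open>The definition provides a cover into some pullback; here the pullback is prescribed. The
  comparison \<open>w\<close> between the two has the section \<open>v\<close>, so it is a cover,
  and \<open>u\<close> is the given cover followed by \<open>w\<close>.\<close>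

lemma quasi_pullback_cover:
  assumes qp: "quasi_pullback q g f p" and pb: "is_pullback E b c f p"
    and u: "u \<in> hom E D (Dom E b)" "b \<cdot> u = q" "c \<cdot> u = g"
  shows "is_cover E u"
proof -
  obtain P B C A where ty: "b \<in> hom E P B" "c \<in> hom E P C" "f \<in> hom E B A" "p \<in> hom E C A"
    and eq: "f \<cdot> b = p \<cdot> c" using pb by (rule pullbackE)
  have q: "q \<in> hom E D B" using u(1) ty by (simp add: u(2)[symmetric] hom_def)
  obtain b' c' u' where pb': "is_pullback E b' c' f p" and u': "u' \<in> hom E (Dom E q) (Dom E b')"
    "b' \<cdot> u' = q" "c' \<cdot> u' = g" "is_cover E u'"
    using qp unfolding quasi_pullback_def by blast
  obtain P' where ty': "b' \<in> hom E P' B" "c' \<in> hom E P' C" and eq': "f \<cdot> b' = p \<cdot> c'"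
    using pb' ty by (elim pullbackE) (auto simp: hom_def)
  obtain w where w: "w \<in> hom E P' P" "b \<cdot> w = b'" "c \<cdot> w = c'"
    using pullback_fac[OF pb, of b' P' c'] ty ty' eq' by (auto simp: hom_def)
  obtain v where v: "v \<in> hom E P P'" "b' \<cdot> v = b" "c' \<cdot> v = c"
    using pullback_fac[OF pb', of b P c] ty ty' eq by (auto simp: hom_def)
  note S = hom_def w(2,3)[THEN reassoc] v(2,3) u(2,3) u'(2,3)
  have o: "P \<in> Ob E" using ty hom_Ob by blast
  have "w \<cdot> v = Id E P"
    by (rule pullback_eq[OF pb, of _ P]) (use o w(1) v(1) ty ty' in \<open>simp_all add: S\<close>)
  then have "is_cover E w"
    using cover_comp_right[of w v P P' P] cover_Id[OF o] w v by simp
  then have "is_cover E (w \<cdot> u')"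
    using cover_comp[of u' D P' w P] u' w q ty' by (simp add: hom_def)
  moreover have "w \<cdot> u' = u"
    by (rule pullback_eq[OF pb, of _ D]) (use w(1) u(1) u'(1) q ty ty' in \<open>simp_all add: S\<close>)
  ultimately show ?thesis by simp
qed

lemma quasi_pullback_of_pullback:
  assumes "is_pullback E q g f p"
  shows "quasi_pullback q g f p"
proof -
  obtain D B C A where ty: "q \<in> hom E D B" "g \<in> hom E D C" "f \<in> hom E B A"
    using assms by (rule pullbackE)
  then have "D \<in> Ob E" using hom_Ob by blast
  then show ?thesis
    using quasi_pullbackI[OF assms cover_Id, of D D] ty by (simp add: hom_def)
qed

lemma quasi_pullback_comp_cover:
  assumes qp: "quasi_pullback q g f p" and h: "is_cover E h" "h \<in> hom E X (Dom E q)"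
  shows "quasi_pullback (q \<cdot> h) (g \<cdot> h) f p"
proof -
  obtain b c u where pb: "is_pullback E b c f p" and u: "u \<in> hom E (Dom E q) (Dom E b)"
    "b \<cdot> u = q" "c \<cdot> u = g" "is_cover E u"
    using qp unfolding quasi_pullback_def by blast
  obtain P B C A where ty: "b \<in> hom E P B" "c \<in> hom E P C" "f \<in> hom E B A" using pb by (rule pullbackE)
  have "is_cover E (u \<cdot> h)" using cover_comp[OF h u(4,1)] .
  moreover have "b \<cdot> (u \<cdot> h) = q \<cdot> h" "c \<cdot> (u \<cdot> h) = g \<cdot> h" "u \<cdot> h \<in> hom E X (Dom E b)"
    using u(1) h ty u(2,3)[THEN reassoc, of h] by (simp_all add: hom_def)
  ultimately show ?thesis using quasi_pullbackI[OF pb, of "u \<cdot> h" X] by simp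
qed

text \<open>Let \<open>D2\<close> be the pullback of \<open>g\<close> along \<open>p'\<close>. The
  comparison from \<open>D'\<close> to the pullback for the whole rectangle passes through
  \<open>D2\<close>: its first part \<open>w\<close> is the cover of the left square, its second
  part \<open>v\<close> is a pullback of the cover \<open>u\<close> of the right square.\<close>

lemma quasi_pullback_paste:
  assumes r: "quasi_pullback q g f p" and l: "quasi_pullback q' g' g p'"
  shows "quasi_pullback (q \<cdot> q') g' f (p \<cdot> p')"
proof -
  obtain D B C A where ty: "q \<in> hom E D B" "g \<in> hom E D C" "f \<in> hom E B A" "p \<in> hom E C A"
    using r by (rule quasi_pullbackE)
  obtain D' C' where ty': "q' \<in> hom E D' D" "g' \<in> hom E D' C'" "p' \<in> hom E C' C"
    using l ty by (elim quasi_pullbackE) (auto simp: hom_def)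
  obtain b c u where pb: "is_pullback E b c f p" and u: "u \<in> hom E (Dom E q) (Dom E b)"
    "b \<cdot> u = q" "c \<cdot> u = g" "is_cover E u"
    using r unfolding quasi_pullback_def by blast
  obtain P where bc: "b \<in> hom E P B" "c \<in> hom E P C"
    using pb ty by (elim pullbackE) (auto simp: hom_def)
  have u1: "u \<in> hom E D P" using u(1) bc ty by (simp add: hom_def)
  obtain b' c' P' where pb': "is_pullback E b' c' c p'" and bc': "b' \<in> hom E P' P" "c' \<in> hom E P' C'"
    using pullback_exists[OF bc(2) ty'(3)] .
  obtain b2 c2 D2 where pb2: "is_pullback E b2 c2 g p'" and bc2: "b2 \<in> hom E D2 D" "c2 \<in> hom E D2 C'"
    using pullback_exists[OF ty(2) ty'(3)] .
  have eq2: "g \<cdot> b2 = p' \<cdot> c2" using pb2 by (simp add: is_pullback_def comm_square_def)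
  obtain v where v: "v \<in> hom E D2 P'" "b' \<cdot> v = u \<cdot> b2" "c' \<cdot> v = c2"
    using pullback_fac[OF pb', of "u \<cdot> b2" D2 c2] eq2 u(3)[THEN reassoc, of b2] bc bc' bc2 u1 ty'
    by (auto simp: hom_def)
  have "is_pullback E v b2 b' u"
    by (rule pullback_cancel[OF pullback_flip[OF pb'] _ v(1) bc'(1) u1 v(2,3)])
      (simp add: u pullback_flip[OF pb2])
  then have "is_cover E v" using cover_pullback pullback_flip u(4) by blast
  obtain w where w: "w \<in> hom E D' D2" "b2 \<cdot> w = q'" "c2 \<cdot> w = g'"
    using pullback_fac[OF pb2, of q' D' g'] l ty ty' bc2
    by (auto simp: hom_def quasi_pullback_def comm_square_def)
  have "is_cover E w" using quasi_pullback_cover[OF l pb2 _ w(2,3)] w(1) bc2 by (auto simp: hom_def)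
  then have vw: "is_cover E (v \<cdot> w)" using cover_comp w(1) \<open>is_cover E v\<close> v(1) by blast
  have "(b \<cdot> b') \<cdot> (v \<cdot> w) = q \<cdot> q'" "c' \<cdot> (v \<cdot> w) = g'" "v \<cdot> w \<in> hom E D' (Dom E (b \<cdot> b'))"
    using v(1) w(1) u1 bc bc' bc2 ty ty' w(2,3) v(2,3)[THEN reassoc, of w] u(2)[THEN reassoc, of "b2 \<cdot> w"]
    by (simp_all add: hom_def)
  then show ?thesis using quasi_pullbackI[OF pullback_paste[OF pb pb'] vw] by metis
qed

text \<open>Pasting a pullback of \<open>g\<close> along \<open>p'\<close> to the right-hand square
  gives a pullback for the outer rectangle, so the left square and the rectangle have the same
  comparison arrow.\<close>

lemma quasi_pullback_cancel:
  assumes r: "is_pullback E q g f p" and o: "quasi_pullback b g' f (p \<cdot> p')"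
    and ty': "q' \<in> hom E D' D" "g \<in> hom E D C" "p' \<in> hom E C' C"
    and eq': "g \<cdot> q' = p' \<cdot> g'" and b: "q \<cdot> q' = b"
  shows "quasi_pullback q' g' g p'"
proof -
  obtain B A where ty: "q \<in> hom E D B" "f \<in> hom E B A" "p \<in> hom E C A"
    using r ty' by (elim pullbackE) (auto simp: hom_def)
  have "b \<in> hom E D' B" using ty ty' by (simp add: b[symmetric] hom_def)
  then have g': "g' \<in> hom E D' C'"
    using o ty ty' by (auto simp: hom_def quasi_pullback_def comm_square_def)
  obtain b1 c1 P where pb: "is_pullback E b1 c1 g p'" and bc: "b1 \<in> hom E P D" "c1 \<in> hom E P C'"
    using pullback_exists[OF ty'(2,3)] .
  obtain u where u: "u \<in> hom E D' P" "b1 \<cdot> u = q'" "c1 \<cdot> u = g'"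
    using pullback_fac[OF pb, of q' D' g'] eq' g' bc ty' by (auto simp: hom_def)
  have "is_cover E u"
    by (rule quasi_pullback_cover[OF o pullback_paste[OF r pb]])
      (use u(1) bc ty b u(2,3) in \<open>auto simp: hom_def\<close>)
  then show ?thesis using quasi_pullbackI[OF pb, of u D'] u bc by (simp add: hom_def)
qed

lemma covering_square_paste:
  assumes r: "covering_square E q g f p" and l: "covering_square E q' g' g p'"
  shows "covering_square E (q \<cdot> q') g' f (p \<cdot> p')"
proof -
  have "p \<in> hom E (Dom E p) (Cod E p)" "p' \<in> hom E (Dom E p') (Dom E p)"
    using r l by (auto simp: covering_square_def comm_square_def hom_def)
  then show ?thesis
    using assms cover_comp quasi_pullback_paste unfolding covering_square_iff by blast
qed

lemma covering_square_pullback: "is_pullback E q g f p \<Longrightarrow> is_cover E p \<Longrightarrow> covering_square E q g f p"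
  by (simp add: covering_square_iff quasi_pullback_of_pullback)

lemma covering_square_cover:
  assumes h: "is_cover E h" "h \<in> hom E X D" and g: "g \<in> hom E D C"
  shows "covering_square E h (g \<cdot> h) g (Id E C)"
proof -
  have "C \<in> Ob E" "D \<in> Ob E" using g hom_Ob by auto
  then show ?thesis
    using quasi_pullback_comp_cover[OF quasi_pullback_of_pullback[OF pullback_Id[OF g]] h(1), of X]
      h cover_Id by (simp add: covering_square_iff hom_def)
qed

section \<open>The relation of one map covering another\<close>

lemma covers_trans: "covers E h g \<Longrightarrow> covers E g f \<Longrightarrow> covers E h f"
  unfolding covers_def using covering_square_paste by blast

lemma covers_refl:
  assumes "f \<in> Mor E"
  shows "covers E f f"
proof -
  have f: "f \<in> hom E (Dom E f) (Cod E f)" using assms by (simp add: hom_def)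
  then have "Cod E f \<in> Ob E" using hom_Ob by blast
  then show ?thesis
    unfolding covers_def using covering_square_pullback[OF pullback_Id[OF f]] cover_Id by blast
qed

text \<open>Pull the bottom \<open>p\<close> back along \<open>a\<close>, and then \<open>g\<close>
  back along the new projection \<open>c\<close>. As \<open>p \<cdot> c = a \<cdot> p'\<close>,
  pasting relates \<open>g'\<close> to \<open>f\<close> over \<open>a \<cdot> p'\<close>, and
  cancelling the pullback of \<open>f\<close> along \<open>a\<close> leaves a square from
  \<open>g'\<close> to \<open>f'\<close>.\<close>

lemma covers_pullback:
  assumes cov: "covers E g f" and pb: "is_pullback E b f' f a"
  obtains y g' c where "is_pullback E y g' g c" "covers E g' f'"
proof -
  obtain q p where "covering_square E q g f p" using cov by (auto simp: covers_def)
  then have p: "is_cover E p" and qp: "quasi_pullback q g f p" by (auto simp: covering_square_iff)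
  obtain D B C A where ty: "q \<in> hom E D B" "g \<in> hom E D C" "f \<in> hom E B A" "p \<in> hom E C A"
    and eq: "f \<cdot> q = p \<cdot> g" using qp by (rule quasi_pullbackE)
  obtain B' A' where ba: "b \<in> hom E B' B" "f' \<in> hom E B' A'" "a \<in> hom E A' A"
    using pb ty by (elim pullbackE) (auto simp: hom_def)
  obtain c p' C' where pc: "is_pullback E c p' p a" and cp: "c \<in> hom E C' C" "p' \<in> hom E C' A'"
    using pullback_exists[OF ty(4) ba(3)] .
  obtain y g' D' where py: "is_pullback E y g' g c" and yg: "y \<in> hom E D' D" "g' \<in> hom E D' C'"
    using pullback_exists[OF ty(2) cp(1)] .
  have eqs: "p \<cdot> c = a \<cdot> p'" "g \<cdot> y = c \<cdot> g'"
    using pc py by (auto simp: is_pullback_def comm_square_def)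
  have o: "quasi_pullback (q \<cdot> y) g' f (a \<cdot> p')"
    using quasi_pullback_paste[OF qp quasi_pullback_of_pullback[OF py]] eqs by simp
  then obtain h where h: "h \<in> hom E D' B'" "b \<cdot> h = q \<cdot> y" "f' \<cdot> h = p' \<cdot> g'"
    using pullback_fac[OF pb, of "q \<cdot> y" D' "p' \<cdot> g'"] ty ba cp yg
    by (auto simp: hom_def quasi_pullback_def comm_square_def)
  have "quasi_pullback h g' f' p'"
    using quasi_pullback_cancel[OF pb o h(1) ba(2) cp(2) h(3,2)] .
  then have "covers E g' f'"
    using cover_pullback[OF pc p] by (auto simp: covers_def covering_square_iff)
  then show thesis using that py by blast
qed

section \<open>Strong collection gives representable classes\<close>

text \<open>The form suited to (S3): composing \<open>k\<close> with the projection \<open>b\<close>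
  turns the factorisation through the pullback \<open>e'\<close> into one through \<open>e\<close>
  itself.\<close>

lemma strong_collectionE:
  assumes sc: "strong_collection_square E q g f p" and pb: "is_pullback E y x g c"
    and e: "is_cover E e" "Cod E e = Dom E x"
  obtains t c' x' y' x'' y'' u h k where
    "is_cover E t" "Cod E t = Dom E c"
    "is_pullback E y' x' g c'" "is_pullback E y'' x'' g (c \<cdot> t)"
    "u \<in> hom E (Dom E x'') (Dom E x)" "x \<cdot> u = t \<cdot> x''" "y \<cdot> u = y''"
    "is_cover E h" "h \<in> hom E (Dom E x') (Dom E x'')" "x'' \<cdot> h = x'"
    "k \<in> hom E (Dom E x') (Dom E e)" "u \<cdot> h = e \<cdot> k"
proof -
  obtain t c' x' y' x'' y'' u a b e' h k where *:
    "is_cover E t" "Cod E t = Dom E c"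
    "is_pullback E y' x' g c'" "is_pullback E y'' x'' g (c \<cdot> t)"
    "u \<in> hom E (Dom E x'') (Dom E x)" "x \<cdot> u = t \<cdot> x''" "y \<cdot> u = y''"
    "is_pullback E b a (x \<cdot> e) t"
    "e' \<in> hom E (Dom E a) (Dom E x'')" "u \<cdot> e' = e \<cdot> b"
    "is_cover E h" "h \<in> hom E (Dom E x') (Dom E x'')" "x'' \<cdot> h = x'"
    "k \<in> hom E (Dom E x') (Dom E a)" "h = e' \<cdot> k"
    using sc[unfolded strong_collection_square_def, THEN conjunct2, rule_format, of y x c e] pb e
    by blast
  have x: "x \<in> Mor E" "e \<in> Mor E"
    using pb e by (auto simp: is_pullback_def comm_square_def is_cover_def)
  have b: "b \<in> Mor E" "Cod E b = Dom E e" "Dom E b = Dom E a"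
    using *(8) x e by (auto simp: is_pullback_def comm_square_def)
  have "u \<cdot> h = e \<cdot> (b \<cdot> k)"
    using *(10)[THEN reassoc, of k] * x b e by (simp add: hom_def)
  moreover have "b \<cdot> k \<in> hom E (Dom E x') (Dom E e)" using b * by (simp add: hom_def)
  ultimately show thesis using that *(1-7,11-13) by blast
qed

lemma SAMC_imp_RP:
  assumes "SAMC E"
  shows "RP E"
  unfolding RP_def
proof
  fix f0 assume "f0 \<in> Mor E"
  then obtain q0 g p0 where cov0: "covering_square E q0 g f0 p0"
    and sc: "strong_collection_square E q0 g f0 p0"
    using assms unfolding SAMC_def by blast
  define S where "S = {f \<in> Mor E. \<exists>q g' p. is_pullback E q g' g p \<and> covers E g' f}"
  have g: "g \<in> Mor E" using cov0 by (simp add: covering_square_def comm_square_def)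
  have pb_S: "g' \<in> S" if "is_pullback E q g' g p" for q g' p
  proof -
    have "g' \<in> Mor E" using that by (simp add: is_pullback_def comm_square_def)
    then show ?thesis using that covers_refl[of g'] unfolding S_def by blast
  qed
  have "g \<in> hom E (Dom E g) (Cod E g)" using g by (simp add: hom_def)
  from pullback_Id[OF this] have gS: "g \<in> S" by (rule pb_S)
  have covers_S: "f \<in> S" if "covers E g' f" "g' \<in> S" for f g'
  proof -
    have "f \<in> Mor E" using that by (auto simp: covers_def covering_square_def comm_square_def)
    then show ?thesis using that covers_trans unfolding S_def by blast
  qed
  have "small_class E S"
    unfolding small_class_def
  proof (intro conjI allI impI)
    show "S \<subseteq> Mor E" by (auto simp: S_def)
  next
    \<comment> \<open>(S1): \<open>h\<close> is covered by a pullback of \<open>g'\<close>, which by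
      pasting is again a pullback of \<open>g\<close>.\<close>
    fix q h f p assume pb: "is_pullback E q h f p \<and> f \<in> S"
    then obtain q' g' p' where g': "is_pullback E q' g' g p'" "covers E g' f" by (auto simp: S_def)
    obtain y g2 c where "is_pullback E y g2 g' c" "covers E g2 h"
      using covers_pullback[OF g'(2)] pb by metis
    then have "is_pullback E (q' \<cdot> y) g2 g (p' \<cdot> c)" "covers E g2 h"
      using pullback_paste[OF g'(1)] by auto
    then show "h \<in> S" using pb_S covers_S by blast
  next
    fix g' f assume "covers E g' f \<and> g' \<in> S"
    then show "f \<in> S" using covers_S by blast
  next
    fix p f assume *: "is_cover E p \<and> f \<in> S \<and> Cod E p = Dom E f"
    obtain y x c where pb: "is_pullback E y x g c" and "covers E x f" using * by (auto simp: S_def)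
    then obtain q1 p1 where cov: "covering_square E q1 x f p1" by (auto simp: covers_def)
    obtain X' X A' A where ty: "q1 \<in> hom E X' X" "x \<in> hom E X' A'" "f \<in> hom E X A" "p1 \<in> hom E A' A"
      using cov by (auto simp: covering_square_iff elim: quasi_pullbackE)
    have p: "p \<in> hom E (Dom E p) X" using * ty by (auto simp: is_cover_def hom_def)
    \<comment> \<open>Pulled back along \<open>q1\<close>, the cover \<open>p\<close> becomes a
      cover \<open>e\<close> of the domain of \<open>x\<close>. Strong collection applies to it
      because \<open>x\<close> is a pullback of \<open>g\<close>.\<close>
    obtain y1 e Y' where pe: "is_pullback E y1 e p q1" and ye: "y1 \<in> hom E Y' (Dom E p)" "e \<in> hom E Y' X'"
      using pullback_exists[OF p ty(1)] .
    have e: "is_cover E e" "p \<cdot> y1 = q1 \<cdot> e"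
      using cover_pullback[OF pe] * pe by (auto simp: is_pullback_def comm_square_def)
    obtain t c' x' y' x'' y'' u h k where sc':
      "is_cover E t" "Cod E t = Dom E c"
      "is_pullback E y' x' g c'" "is_pullback E y'' x'' g (c \<cdot> t)"
      "u \<in> hom E (Dom E x'') (Dom E x)" "x \<cdot> u = t \<cdot> x''" "y \<cdot> u = y''"
      "is_cover E h" "h \<in> hom E (Dom E x') (Dom E x'')" "x'' \<cdot> h = x'"
      "k \<in> hom E (Dom E x') (Dom E e)" "u \<cdot> h = e \<cdot> k"
      by (rule strong_collectionE[OF sc pb e(1)]) (use ye ty in \<open>simp add: hom_def\<close>)
    have c: "Dom E c = A'" using pb ty by (auto simp: is_pullback_def comm_square_def hom_def)
    have t: "t \<in> hom E (Dom E t) A'" using sc'(1,2) c by (simp add: is_cover_def hom_def)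
    have u: "u \<in> hom E (Dom E x'') X'" using sc'(5) ty by (simp add: hom_def)
    have pu: "is_pullback E u x'' x t" using pullback_cancel[OF pb sc'(4) u ty(2) t sc'(6,7)] .
    then have x'': "x'' \<in> hom E (Dom E x'') (Dom E t)"
      by (simp add: is_pullback_def comm_square_def hom_def)
    have h: "covering_square E h x' x'' (Id E (Dom E t))"
      using covering_square_cover[OF sc'(8,9) x''] sc'(10) by simp
    \<comment> \<open>Three squares are pasted: \<open>h\<close> over an identity, the pullback
      square of \<open>u\<close> over \<open>t\<close>, and the square by which \<open>x\<close>
      covers \<open>f\<close>. The top factors through \<open>p\<close> because
      \<open>u \<cdot> h = e \<cdot> k\<close>.\<close>
    have "covering_square E (q1 \<cdot> (u \<cdot> h)) x' f (p1 \<cdot> (t \<cdot> Id E (Dom E t)))"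
      using cov h covering_square_pullback[OF pu sc'(1)] covering_square_paste by blast
    moreover have "q1 \<cdot> (u \<cdot> h) = p \<cdot> (y1 \<cdot> k)" "y1 \<cdot> k \<in> hom E (Dom E (q1 \<cdot> (u \<cdot> h))) (Dom E p)"
      unfolding sc'(12) using e(2)[THEN reassoc, of k] sc'(11) ye p ty by (simp_all add: hom_def)
    ultimately show "\<exists>q g b k. covering_square E q g f b \<and> g \<in> S \<and>
        k \<in> hom E (Dom E q) (Dom E p) \<and> q = p \<cdot> k"
      using pb_S[OF sc'(3)] by blast
  qed
  moreover have "representable E S"
    using gS by (auto simp: representable_def representation_def S_def)
  moreover have "f0 \<in> S" using covers_S[of g f0] cov0 gS by (auto simp: covers_def)
  ultimately show "\<exists>S. small_class E S \<and> representable E S \<and> f0 \<in> S" by blast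
qed

end

section \<open>Dependent products\<close>

lemma hom_slice:
  "t \<in> hom (slice E A) f g \<longleftrightarrow>
     (\<exists>h. t = (f, h, g) \<and> f \<in> hom E (Dom E f) A \<and> g \<in> hom E (Dom E g) A \<and>
       h \<in> hom E (Dom E f) (Dom E g) \<and> g \<cdot>\<^bsub>E\<^esub> h = f)"
  by (auto simp: slice_def hom_def)

lemma Ob_slice: "f \<in> Ob (slice E A) \<longleftrightarrow> f \<in> hom E (Dom E f) A"
  by (auto simp: slice_def hom_def)

lemma Mor_slice: "t \<in> Mor (slice E A) \<longleftrightarrow> (\<exists>f g. t \<in> hom (slice E A) f g)"
  by (auto simp: hom_def)

lemma Id_slice: "Id (slice E A) f = (f, Id E (Dom E f), f)"
  by (simp add: slice_def)

lemma Comp_slice: "(g, k, l) \<cdot>\<^bsub>slice E A\<^esub> (f, h, g') = (f, k \<cdot>\<^bsub>E\<^esub> h, l)"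
  by (simp add: slice_def)

context regular_category
begin

lemma category_slice: "category (slice E A)"
proof
  fix f assume "f \<in> Mor (slice E A)"
  then show "Dom (slice E A) f \<in> Ob (slice E A)" "Cod (slice E A) f \<in> Ob (slice E A)"
    by (auto simp: slice_def)
next
  fix f assume "f \<in> Ob (slice E A)"
  then show "Id (slice E A) f \<in> hom (slice E A) f f"
    using Dom_Ob[of f] by (auto simp: slice_def hom_def)
next
  fix f g h s t assume "s \<in> hom (slice E A) f g" "t \<in> hom (slice E A) g h"
  then obtain b c where s: "s = (f, b, g)" and t: "t = (g, c, h)"
    and ty: "f \<in> hom E (Dom E f) A" "g \<in> hom E (Dom E g) A" "h \<in> hom E (Dom E h) A"
      "b \<in> hom E (Dom E f) (Dom E g)" "c \<in> hom E (Dom E g) (Dom E h)"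
    and eq: "g \<cdot> b = f" "h \<cdot> c = g"
    by (auto simp: hom_slice)
  have "h \<cdot> (c \<cdot> b) = f" using eq(2)[THEN reassoc, of b] eq(1) ty by (simp add: hom_def)
  moreover have "c \<cdot> b \<in> hom E (Dom E f) (Dom E h)" using ty Comp_hom by blast
  ultimately show "t \<cdot>\<^bsub>slice E A\<^esub> s \<in> hom (slice E A) f h"
    using ty by (simp add: hom_slice s t Comp_slice)
next
  fix f g h i s t r
  assume "s \<in> hom (slice E A) f g" "t \<in> hom (slice E A) g h" "r \<in> hom (slice E A) h i"
  then obtain b c d where s: "s = (f, b, g)" and t: "t = (g, c, h)" and r: "r = (h, d, i)"
    and ty: "b \<in> hom E (Dom E f) (Dom E g)" "c \<in> hom E (Dom E g) (Dom E h)"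
      "d \<in> hom E (Dom E h) (Dom E i)"
    by (auto simp: hom_slice)
  show "r \<cdot>\<^bsub>slice E A\<^esub> t \<cdot>\<^bsub>slice E A\<^esub> s = r \<cdot>\<^bsub>slice E A\<^esub> (t \<cdot>\<^bsub>slice E A\<^esub> s)"
    using Comp_assoc[OF ty] by (simp add: s t r Comp_slice)
next
  fix f g s assume "s \<in> hom (slice E A) f g"
  then obtain b where s: "s = (f, b, g)" and b: "b \<in> hom E (Dom E f) (Dom E g)"
    by (auto simp: hom_slice)
  show "s \<cdot>\<^bsub>slice E A\<^esub> Id (slice E A) f = s" "Id (slice E A) g \<cdot>\<^bsub>slice E A\<^esub> s = s"
    using Comp_Id[OF b] Id_Comp[OF b] by (simp_all add: s Comp_slice Id_slice)
qed

text \<open>Local cartesian closure speaks about given pullback functors, so one has to be built.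
  Pullback squares are chosen for all objects of the slice; \<open>K x h y\<close> is the induced
  arrow between two of them, and its uniqueness \<open>K_eq\<close> gives both functor laws.\<close>

lemma pullback_functor_exists:
  assumes u: "u \<in> hom E X Y"
  obtains F K q where
    "is_pullback_functor E u F (\<lambda>(x, h, y). (F x, K x h y, F y))"
    "\<forall>x\<in>Ob (slice E Y). is_pullback E (q x) (F x) x u"
    "\<forall>x h y. (x, h, y) \<in> hom (slice E Y) x y \<longrightarrow>
      K x h y \<in> hom E (Dom E (F x)) (Dom E (F y)) \<and> q y \<cdot> K x h y = h \<cdot> q x \<and> F y \<cdot> K x h y = F x"
proof -
  have "\<exists>q g. is_pullback E q g x u" if "x \<in> Ob (slice E Y)" for x
    using pullback_exists[of x "Dom E x" Y u X] that u by (metis Ob_slice)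
  then obtain q F where pb: "\<And>x. x \<in> Ob (slice E Y) \<Longrightarrow> is_pullback E (q x) (F x) x u"
    by metis
  have qF: "q x \<in> hom E (Dom E (F x)) (Dom E x)" "F x \<in> hom E (Dom E (F x)) X" "x \<cdot> q x = u \<cdot> F x"
    "Dom E (q x) = Dom E (F x)"
    if "x \<in> Ob (slice E Y)" for x
    using pb[OF that] u by (auto simp: is_pullback_def comm_square_def hom_def)
  have ex: "\<exists>k. k \<in> hom E (Dom E (F x)) (Dom E (F y)) \<and> q y \<cdot> k = h \<cdot> q x \<and> F y \<cdot> k = F x"
    if h: "(x, h, y) \<in> hom (slice E Y) x y" for x h y
  proof -
    have o: "x \<in> Ob (slice E Y)" "y \<in> Ob (slice E Y)" using h by (auto simp: hom_slice Ob_slice)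
    have h': "h \<in> hom E (Dom E x) (Dom E y)" "y \<cdot> h = x" "x \<in> hom E (Dom E x) Y" "y \<in> hom E (Dom E y) Y"
      using h by (auto simp: hom_slice)
    have "y \<cdot> (h \<cdot> q x) = u \<cdot> F x"
      using h' qF[OF o(1)] h'(2)[THEN reassoc, of "q x"] by (simp add: hom_def)
    moreover have "h \<cdot> q x \<in> hom E (Dom E (F x)) (Dom E y)" "F x \<in> hom E (Dom E (F x)) (Dom E u)"
      using h' qF[OF o(1)] u by (simp_all add: hom_def)
    ultimately show ?thesis
      using pullback_fac[OF pb[OF o(2)], of "h \<cdot> q x" "Dom E (F x)" "F x"] qF(4)[OF o(2)] by metis
  qed
  define K where "K = (\<lambda>x h y. SOME k. k \<in> hom E (Dom E (F x)) (Dom E (F y)) \<and>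
    q y \<cdot> k = h \<cdot> q x \<and> F y \<cdot> k = F x)"
  have K: "K x h y \<in> hom E (Dom E (F x)) (Dom E (F y))" "q y \<cdot> K x h y = h \<cdot> q x" "F y \<cdot> K x h y = F x"
    if h: "(x, h, y) \<in> hom (slice E Y) x y" for x h y
    using someI_ex[OF ex[OF that]] unfolding K_def by blast+
  have K_eq: "K x h y = k" if "(x, h, y) \<in> hom (slice E Y) x y"
    "k \<in> hom E (Dom E (F x)) (Dom E (F y))" "q y \<cdot> k = h \<cdot> q x" "F y \<cdot> k = F x" for x h y k
  proof -
    have o: "y \<in> Ob (slice E Y)" using that by (auto simp: hom_slice Ob_slice)
    show ?thesis
      by (rule pullback_eq[OF pb[OF o], of _ "Dom E (F x)"]) (use K that qF(4)[OF o] in auto)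
  qed
  have cod: "Cod E u = Y" "Dom E u = X" using u by (auto simp: hom_def)
  let ?Fm = "\<lambda>(x, h, y). (F x, K x h y, F y)"
  have "is_functor (slice E Y) (slice E X) F ?Fm"
    unfolding is_functor_def
  proof (intro conjI ballI allI impI)
    show "category (slice E Y)" "category (slice E X)" by (rule category_slice)+
  next
    fix x assume "x \<in> Ob (slice E Y)"
    then show "F x \<in> Ob (slice E X)" using qF by (simp add: Ob_slice)
  next
    fix x y t assume t: "t \<in> hom (slice E Y) x y"
    then obtain h where h: "t = (x, h, y)" by (auto simp: hom_slice)
    moreover have "x \<in> Ob (slice E Y)" "y \<in> Ob (slice E Y)" using t by (auto simp: hom_slice Ob_slice)
    ultimately show "?Fm t \<in> hom (slice E X) (F x) (F y)"
      using K[of x h y] t qF by (auto simp: hom_slice)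
  next
    fix x assume x: "x \<in> Ob (slice E Y)"
    have ty: "x \<in> hom E (Dom E x) Y" "F x \<in> hom E (Dom E (F x)) X" using x qF by (auto simp: Ob_slice)
    have "Dom E x \<in> Ob E" "Dom E (F x) \<in> Ob E" using ty hom_Ob by auto
    then have "K x (Id E (Dom E x)) x = Id E (Dom E (F x))"
      by (intro K_eq) (use ty qF[OF x] in \<open>auto simp: slice_def hom_def\<close>)
    then show "?Fm (Id (slice E Y) x) = Id (slice E X) (F x)" by (simp add: Id_slice)
  next
    fix x y z s t assume st: "s \<in> hom (slice E Y) x y \<and> t \<in> hom (slice E Y) y z"
    then obtain h k where hk: "s = (x, h, y)" "t = (y, k, z)" by (auto simp: hom_slice)
    have c: "(x, k \<cdot> h, z) \<in> hom (slice E Y) x z"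
      using category.Comp_hom[OF category_slice, of s Y x y t z] st unfolding hk Comp_slice by blast
    have o: "x \<in> Ob (slice E Y)" "y \<in> Ob (slice E Y)" "z \<in> Ob (slice E Y)"
      using st by (auto simp: hom_slice Ob_slice)
    have ty: "h \<in> hom E (Dom E x) (Dom E y)" "k \<in> hom E (Dom E y) (Dom E z)"
      using st hk by (auto simp: hom_slice)
    have Kh: "K x h y \<in> hom E (Dom E (F x)) (Dom E (F y))" "q y \<cdot> K x h y = h \<cdot> q x" "F y \<cdot> K x h y = F x"
      and Kk: "K y k z \<in> hom E (Dom E (F y)) (Dom E (F z))" "q z \<cdot> K y k z = k \<cdot> q y" "F z \<cdot> K y k z = F y"
      using K st hk by blast+
    have "K x (k \<cdot> h) z = K y k z \<cdot> K x h y"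
      by (rule K_eq[OF c])
        (use Kh Kk(1) Kk(2,3)[THEN reassoc, of "K x h y"] ty qF[OF o(1)] qF[OF o(2)] qF[OF o(3)]
          in \<open>simp_all add: hom_def\<close>)
    then show "?Fm (t \<cdot>\<^bsub>slice E Y\<^esub> s) = ?Fm t \<cdot>\<^bsub>slice E X\<^esub> ?Fm s" by (simp add: hk Comp_slice)
  qed
  moreover have "\<exists>k. ?Fm (x, h, y) = (F x, k, F y) \<and> q y \<cdot> k = h \<cdot> q x"
    if "(x, h, y) \<in> Mor (slice E Y)" for x h y
  proof -
    have "(x, h, y) \<in> hom (slice E Y) x y" using that by (auto simp: Mor_slice hom_slice)
    then show ?thesis using K by simp
  qed
  ultimately have "is_pullback_functor E u F ?Fm"
    unfolding is_pullback_functor_def cod using pb by blast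
  then show thesis using that[of F K q] pb K by blast
qed

text \<open>\<open>p\<close> is the dependent product of \<open>z\<close> along \<open>u\<close> and \<open>\<epsilon>\<close> is its evaluation.  In the universal property, \<open>k\<close>
  is the arrow between pullbacks along \<open>u\<close> that is induced by \<open>h\<close>.\<close>

lemma dependent_product_exists:
  assumes lcc: "locally_cartesian_closed E" and u: "u \<in> hom E X Y" and z: "z \<in> hom E Z X"
  obtains p P q g Q \<epsilon> where "p \<in> hom E P Y" "is_pullback E q g p u" "q \<in> hom E Q P" "g \<in> hom E Q X"
    "\<epsilon> \<in> hom E Q Z" "z \<cdot> \<epsilon> = g"
    "\<forall>T x q' g' Q' f. x \<in> hom E T Y \<longrightarrow> is_pullback E q' g' x u \<longrightarrow> f \<in> hom E Q' Z \<longrightarrow> z \<cdot> f = g' \<longrightarrow>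
      (\<exists>h. h \<in> hom E T P \<and> p \<cdot> h = x \<and> (\<forall>k\<in>hom E Q' Q. q \<cdot> k = h \<cdot> q' \<and> g \<cdot> k = g' \<longrightarrow> \<epsilon> \<cdot> k = f))"
proof -
  obtain q F K where PF: "is_pullback_functor E u F (\<lambda>(x, h, y). (F x, K x h y, F y))"
    and pb_all: "\<forall>x\<in>Ob (slice E Y). is_pullback E (q x) (F x) x u"
    and K_all: "\<forall>x h y. (x, h, y) \<in> hom (slice E Y) x y \<longrightarrow>
      K x h y \<in> hom E (Dom E (F x)) (Dom E (F y)) \<and> q y \<cdot> K x h y = h \<cdot> q x \<and> F y \<cdot> K x h y = F x"
    by (rule pullback_functor_exists[OF u])
  note pb = pb_all[rule_format] and K = K_all[rule_format]
  let ?C = "slice E Y" and ?D = "slice E X" and ?Fm = "\<lambda>(x, h, y). (F x, K x h y, F y)"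
  have uty: "u \<in> Mor E" "Dom E u = X" "Cod E u = Y" using u by (auto simp: hom_def)
  have "has_right_adjoint (slice E (Cod E u)) (slice E (Dom E u)) F ?Fm"
    using lcc[unfolded locally_cartesian_closed_def, THEN conjunct2] PF uty(1) by blast
  then obtain G Gm \<phi> where adj: "is_adjunction ?C ?D F ?Fm G Gm \<phi>"
    unfolding has_right_adjoint_def uty by blast
  have fun_G: "is_functor ?D ?C G Gm"
    and bij: "\<And>x y. x \<in> Ob ?C \<Longrightarrow> y \<in> Ob ?D \<Longrightarrow> bij_betw (\<phi> x y) (hom ?D (F x) y) (hom ?C x (G y))"
    and nat: "\<And>x x' y y' a b f. a \<in> hom ?C x' x \<Longrightarrow> b \<in> hom ?D y y' \<Longrightarrow> f \<in> hom ?D (F x) y \<Longrightarrow>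
        \<phi> x' y' (b \<cdot>\<^bsub>?D\<^esub> f \<cdot>\<^bsub>?D\<^esub> ?Fm a) = Gm b \<cdot>\<^bsub>?C\<^esub> \<phi> x y f \<cdot>\<^bsub>?C\<^esub> a"
    using adj unfolding is_adjunction_def by blast+
  interpret C: category ?C by (rule category_slice)
  interpret D: category ?D by (rule category_slice)
  have zO: "z \<in> Ob ?D" and Dz: "Dom E z = Z" using z by (auto simp: Ob_slice hom_def)
  define p where "p = G z"
  have pO: "p \<in> Ob ?C" using fun_G zO by (simp add: is_functor_def p_def)
  have p: "p \<in> hom E (Dom E p) Y" using pO by (simp add: Ob_slice)
  have qF: "q x \<in> hom E (Dom E (F x)) (Dom E x)" "F x \<in> hom E (Dom E (F x)) X"
    "Dom E (q x) = Dom E (F x)" "x \<cdot> q x = u \<cdot> F x"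
    if "x \<in> Ob ?C" for x
    using pb[OF that] u by (auto simp: is_pullback_def comm_square_def hom_def)
  \<comment> \<open>The counit at \<open>z\<close>: the arrow whose transpose is the identity of
    \<open>p = G z\<close>. Its middle component is the evaluation
    \<open>\<epsilon>\<close>.\<close>
  obtain et where et: "et \<in> hom ?D (F p) z" "\<phi> p z et = Id ?C p"
    using bij[OF pO zO] C.Id_hom[OF pO] unfolding bij_betw_def p_def by (metis imageE)
  then obtain \<epsilon> where \<epsilon>: "et = (F p, \<epsilon>, z)" "\<epsilon> \<in> hom E (Dom E (F p)) Z" "z \<cdot> \<epsilon> = F p"
    by (auto simp: hom_slice Dz)
  show thesis
  proof (rule that[OF p pb[OF pO] qF(1,2)[OF pO] \<epsilon>(2,3)], intro allI impI)
    fix T x q' g' Q' f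
    assume x: "x \<in> hom E T Y" and pb': "is_pullback E q' g' x u" and f: "f \<in> hom E Q' Z" and zf: "z \<cdot> f = g'"
    have xO: "x \<in> Ob ?C" and Dx: "Dom E x = T" using x by (auto simp: Ob_slice hom_def)
    have g': "g' \<in> hom E Q' X" using z f by (auto simp: zf[symmetric] hom_def)
    have q': "q' \<in> hom E Q' T" "x \<cdot> q' = u \<cdot> g'" "Dom E q' = Q'"
      using pb' g' x by (auto simp: is_pullback_def comm_square_def hom_def)
    note qFx = qF[OF xO, unfolded Dx]
    \<comment> \<open>The given pullback of \<open>x\<close> need not be the chosen one. The arrows
      \<open>i\<close> and \<open>j\<close> compare the two, and \<open>f\<close> is transposed
      after transport along \<open>i\<close>.\<close>
    obtain i where i: "i \<in> hom E (Dom E (F x)) Q'" "q' \<cdot> i = q x" "g' \<cdot> i = F x"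
      using pullback_fac[OF pb', of "q x" "Dom E (F x)" "F x", unfolded Dx uty] qFx q'(3) by metis
    obtain j where j: "j \<in> hom E Q' (Dom E (F x))" "q x \<cdot> j = q'" "F x \<cdot> j = g'"
      using pullback_fac[OF pb[OF xO], of q' Q' g', unfolded Dx uty] q' g' qFx(3) by metis
    have oQ: "Q' \<in> Ob E" using g' hom_Ob by blast
    have ij: "i \<cdot> j = Id E Q'"
      by (rule pullback_eq[OF pb', of _ Q'])
        (use i(1) j q' g' oQ i(2,3)[THEN reassoc, of j] in \<open>simp_all add: hom_def\<close>)
    have "z \<cdot> (f \<cdot> i) = F x" using zf[THEN reassoc, of i] i f z by (simp add: hom_def)
    then have ft: "(F x, f \<cdot> i, z) \<in> hom ?D (F x) z"
      using f i(1) z qFx unfolding hom_slice Dz by (simp add: hom_def)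
    then have "\<phi> x z (F x, f \<cdot> i, z) \<in> hom ?C x p"
      using bij[OF xO zO] unfolding p_def by (auto dest: bij_betwE)
    then obtain h where h: "\<phi> x z (F x, f \<cdot> i, z) = (x, h, p)" "(x, h, p) \<in> hom ?C x p"
      by (auto simp: hom_slice)
    then have h': "h \<in> hom E T (Dom E p)" "p \<cdot> h = x" by (auto simp: hom_slice Dx)
    note Kh = K[OF h(2)]
    have eF: "et \<cdot>\<^bsub>?D\<^esub> ?Fm (x, h, p) = (F x, \<epsilon> \<cdot> K x h p, z)" by (simp add: \<epsilon>(1) Comp_slice)
    have eFh: "(F x, \<epsilon> \<cdot> K x h p, z) \<in> hom ?D (F x) z"
    proof -
      have "z \<cdot> (\<epsilon> \<cdot> K x h p) = F x"
        using \<epsilon>(3)[THEN reassoc, of "K x h p"] Kh \<epsilon>(2) z by (simp add: hom_def)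
      then show ?thesis using Kh \<epsilon>(2) z qFx unfolding hom_slice Dz by (simp add: hom_def)
    qed
    \<comment> \<open>By naturality, with the identity of \<open>z\<close> in the second variable,
      \<open>h\<close> is the transpose of \<open>\<epsilon> \<cdot> K x h p\<close>. It is also
      that of \<open>f \<cdot> i\<close>, so the two agree by injectivity of
      \<open>\<phi> x z\<close>.\<close>
    have "Gm (Id ?D z) = Id ?C p" using fun_G zO by (simp add: is_functor_def p_def)
    then have "\<phi> x z (Id ?D z \<cdot>\<^bsub>?D\<^esub> et \<cdot>\<^bsub>?D\<^esub> ?Fm (x, h, p)) = Id ?C p \<cdot>\<^bsub>?C\<^esub> Id ?C p \<cdot>\<^bsub>?C\<^esub> (x, h, p)"
      using nat[OF h(2) D.Id_hom[OF zO] et(1)] et(2) by simp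
    moreover have "Id ?D z \<cdot>\<^bsub>?D\<^esub> et \<cdot>\<^bsub>?D\<^esub> ?Fm (x, h, p) = (F x, \<epsilon> \<cdot> K x h p, z)"
      using D.Id_Comp[OF et(1)] eF by simp
    moreover have "Id ?C p \<cdot>\<^bsub>?C\<^esub> Id ?C p \<cdot>\<^bsub>?C\<^esub> (x, h, p) = (x, h, p)"
      using C.Id_Comp[OF C.Id_hom[OF pO]] C.Id_Comp[OF h(2)] by simp
    ultimately have "\<phi> x z (F x, \<epsilon> \<cdot> K x h p, z) = \<phi> x z (F x, f \<cdot> i, z)" using h(1) by simp
    then have "(F x, \<epsilon> \<cdot> K x h p, z) = (F x, f \<cdot> i, z)"
      using bij[OF xO zO] ft eFh by (auto simp: bij_betw_def dest: inj_onD)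
    then have eK: "\<epsilon> \<cdot> K x h p = f \<cdot> i" by simp
    have "\<epsilon> \<cdot> k = f" if k: "k \<in> hom E Q' (Dom E (F p))" "q p \<cdot> k = h \<cdot> q'" "F p \<cdot> k = g'" for k
    proof -
      \<comment> \<open>Both sides have the same projections from the chosen pullback of
        \<open>p\<close>; thus the evaluation equation just found is carried back along
        \<open>j\<close>.\<close>
      have "K x h p \<cdot> j = k"
        by (rule pullback_eq[OF pb[OF pO], of _ Q'])
          (use Kh[THEN conjunct1] Kh[THEN conjunct2, THEN conjunct1, THEN reassoc, of j]
            Kh[THEN conjunct2, THEN conjunct2, THEN reassoc, of j] qF[OF pO] qFx j k h'
            in \<open>simp_all add: hom_def\<close>)
      then have "\<epsilon> \<cdot> k = (\<epsilon> \<cdot> K x h p) \<cdot> j" using \<epsilon>(2) Kh j(1) by (auto simp: hom_def)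
      also have "\<dots> = f" using eK ij f i(1) j(1) by (simp add: hom_def)
      finally show ?thesis .
    qed
    then show "\<exists>h. h \<in> hom E T (Dom E p) \<and> p \<cdot> h = x \<and>
        (\<forall>k\<in>hom E Q' (Dom E (F p)). q p \<cdot> k = h \<cdot> q' \<and> F p \<cdot> k = g' \<longrightarrow> \<epsilon> \<cdot> k = f)"
      using h' by blast
  qed
qed

section \<open>Representable classes give strong collection\<close>

text \<open>The object \<open>P\<close> below consists of the triples \<open>(a, w, \<phi>)\<close> with \<open>\<phi>\<close> an arrow from the fibre \<open>V\<^sub>w\<close> to the
  fibre \<open>B\<^sub>a\<close>.\<close>

lemma fibre_maps_object_exists:
  assumes lcc: "locally_cartesian_closed E" and f: "f \<in> hom E B A" and \<pi>: "\<pi> \<in> hom E V U"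
  obtains aP P wP vP rP VP \<phi>P where "aP \<in> hom E P A" "wP \<in> hom E P U" "is_pullback E vP rP \<pi> wP"
    "vP \<in> hom E VP V" "rP \<in> hom E VP P" "\<phi>P \<in> hom E VP B" "f \<cdot> \<phi>P = aP \<cdot> rP"
    "\<forall>T a w v r VT \<phi>. a \<in> hom E T A \<longrightarrow> w \<in> hom E T U \<longrightarrow> is_pullback E v r \<pi> w \<longrightarrow>
      \<phi> \<in> hom E VT B \<longrightarrow> f \<cdot> \<phi> = a \<cdot> r \<longrightarrow>
      (\<exists>h. h \<in> hom E T P \<and> aP \<cdot> h = a \<and> wP \<cdot> h = w \<and>
        (\<forall>k\<in>hom E VT VP. vP \<cdot> k = v \<and> rP \<cdot> k = h \<cdot> r \<longrightarrow> \<phi>P \<cdot> k = \<phi>))"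
proof -
  have "A \<in> Ob E" "U \<in> Ob E" using f \<pi> hom_Ob by auto
  then obtain AU pA pU where pAU: "pA \<in> hom E AU A" "pU \<in> hom E AU U"
    and ex: "\<And>T x y. x \<in> hom E T A \<Longrightarrow> y \<in> hom E T U \<Longrightarrow> \<exists>u. u \<in> hom E T AU \<and> pA \<cdot> u = x \<and> pU \<cdot> u = y"
    by (rule product_exists) blast
  \<comment> \<open>The elements of \<open>AU\<close> are pairs \<open>(a, w)\<close>, those of
    \<open>AV\<close> add a point \<open>v\<close> of the fibre over \<open>w\<close>, and those of
    \<open>Z\<close> add further a point of the fibre of \<open>f\<close> over \<open>a\<close>. So
    the dependent product of \<open>z\<close> along \<open>s\<close> has, over
    \<open>(a, w)\<close>, the arrows from the fibre of \<open>\<pi>\<close> over \<open>w\<close>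
    to the fibre of \<open>f\<close> over \<open>a\<close>.\<close>
  obtain qV s AV where pbV: "is_pullback E qV s \<pi> pU" and qV: "qV \<in> hom E AV V" "s \<in> hom E AV AU"
    using pullback_exists[OF \<pi> pAU(2)] .
  have "pA \<cdot> s \<in> hom E AV A" using qV pAU by (simp add: hom_def)
  then obtain qB z Z where pbZ: "is_pullback E qB z f (pA \<cdot> s)" and qB: "qB \<in> hom E Z B" "z \<in> hom E Z AV"
    using pullback_exists[OF f] by blast
  obtain p P q g Q \<epsilon> where p: "p \<in> hom E P AU" and pbQ: "is_pullback E q g p s"
    and q: "q \<in> hom E Q P" "g \<in> hom E Q AV" and \<epsilon>: "\<epsilon> \<in> hom E Q Z" "z \<cdot> \<epsilon> = g"
    and univ: "\<forall>T x q' g' Q' f. x \<in> hom E T AU \<longrightarrow> is_pullback E q' g' x s \<longrightarrow> f \<in> hom E Q' Z \<longrightarrow> z \<cdot> f = g' \<longrightarrow>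
      (\<exists>h. h \<in> hom E T P \<and> p \<cdot> h = x \<and> (\<forall>k\<in>hom E Q' Q. q \<cdot> k = h \<cdot> q' \<and> g \<cdot> k = g' \<longrightarrow> \<epsilon> \<cdot> k = f))"
    by (rule dependent_product_exists[OF lcc qV(2) qB(2)])
  have eqV: "\<pi> \<cdot> qV = pU \<cdot> s" and eqZ: "f \<cdot> qB = pA \<cdot> (s \<cdot> z)" and eqQ: "p \<cdot> q = s \<cdot> g"
    using pbV pbZ pbQ qB qV pAU by (auto simp: is_pullback_def comm_square_def hom_def)
  \<comment> \<open>Pasting identifies \<open>Q\<close> with the pullback of \<open>\<pi>\<close>
    along \<open>pU \<cdot> p\<close>, on which \<open>qB \<cdot> \<epsilon>\<close>
    evaluates.\<close>
  have pbP: "is_pullback E (qV \<cdot> g) q \<pi> (pU \<cdot> p)"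
    by (rule pullback_paste[OF pbV pullback_flip[OF pbQ]])
  show thesis
  proof (rule that[of "pA \<cdot> p" P "pU \<cdot> p" "qV \<cdot> g" q Q "qB \<cdot> \<epsilon>"])
    show "pA \<cdot> p \<in> hom E P A" "pU \<cdot> p \<in> hom E P U" "is_pullback E (qV \<cdot> g) q \<pi> (pU \<cdot> p)"
      "qV \<cdot> g \<in> hom E Q V" "q \<in> hom E Q P" "qB \<cdot> \<epsilon> \<in> hom E Q B"
      using pbP p q qV qB \<epsilon>(1) pAU by (simp_all add: hom_def)
    show "f \<cdot> (qB \<cdot> \<epsilon>) = pA \<cdot> p \<cdot> q"
      using eqZ[THEN reassoc, of \<epsilon>] \<epsilon> eqQ f p q qV qB pAU by (simp add: hom_def)
    show "\<forall>T a w v r VT \<phi>. a \<in> hom E T A \<longrightarrow> w \<in> hom E T U \<longrightarrow> is_pullback E v r \<pi> w \<longrightarrow>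
      \<phi> \<in> hom E VT B \<longrightarrow> f \<cdot> \<phi> = a \<cdot> r \<longrightarrow>
      (\<exists>h. h \<in> hom E T P \<and> pA \<cdot> p \<cdot> h = a \<and> pU \<cdot> p \<cdot> h = w \<and>
        (\<forall>k\<in>hom E VT Q. qV \<cdot> g \<cdot> k = v \<and> q \<cdot> k = h \<cdot> r \<longrightarrow> qB \<cdot> \<epsilon> \<cdot> k = \<phi>))"
    proof (intro allI impI)
      fix T a w v r VT' \<phi>
      assume a: "a \<in> hom E T A" and w: "w \<in> hom E T U" and pb: "is_pullback E v r \<pi> w"
        and \<phi>: "\<phi> \<in> hom E VT' B" and eq: "f \<cdot> \<phi> = a \<cdot> r"
      obtain VT where v: "v \<in> hom E VT V" "r \<in> hom E VT T" "\<pi> \<cdot> v = w \<cdot> r"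
        using pb w \<pi> by (elim pullbackE) (auto simp: hom_def)
      \<comment> \<open>Equal arrows have equal domains, which identifies the object
        \<open>VT'\<close> with the domain of \<open>r\<close>.\<close>
      have "Dom E (f \<cdot> \<phi>) = VT'" "Dom E (a \<cdot> r) = VT" using f a v \<phi> by (simp_all add: hom_def)
      then have VT: "VT' = VT" using eq by simp
      obtain m where m: "m \<in> hom E T AU" "pA \<cdot> m = a" "pU \<cdot> m = w" using ex[OF a w] by blast
      have m': "pA \<cdot> (m \<cdot> r) = a \<cdot> r" "pU \<cdot> (m \<cdot> r) = w \<cdot> r"
        using m(2,3)[THEN reassoc, of r] m(1) v pAU by (simp_all add: hom_def)
      have mr: "m \<cdot> r \<in> hom E VT AU" using m v Comp_hom by blast
      have doms: "Dom E \<pi> = V" "Dom E pU = AU" "Dom E qV = AV" "Dom E f = B" "Dom E (pA \<cdot> s) = AV"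
        "Dom E qB = Z"
        using \<pi> pAU qV f qB by (auto simp: hom_def)
      \<comment> \<open>The object \<open>VT\<close> is also the pullback of \<open>s\<close> along
        \<open>m\<close>, the pairing of \<open>a\<close> and \<open>w\<close>. Over
        \<open>AV\<close>, the arrow \<open>\<phi>\<close> becomes an arrow \<open>\<phi>'\<close>
        into \<open>Z\<close>.\<close>
      obtain n where n: "n \<in> hom E VT AV" "qV \<cdot> n = v" "s \<cdot> n = m \<cdot> r"
        using pullback_fac[OF pbV, of v VT "m \<cdot> r"] v mr m' unfolding doms by metis
      have pbn: "is_pullback E r n m s"
        using pullback_flip[OF pullback_cancel[OF pbV _ n(1) qV(2) m(1) n(3,2)]] pb m(3) by blast
      have "(pA \<cdot> s) \<cdot> n = f \<cdot> \<phi>" using n m' eq qV pAU by (simp add: hom_def)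
      then obtain \<phi>' where \<phi>': "\<phi>' \<in> hom E VT Z" "qB \<cdot> \<phi>' = \<phi>" "z \<cdot> \<phi>' = n"
        using pullback_fac[OF pbZ, of \<phi> VT n] \<phi> n(1) unfolding doms VT by metis
      obtain h where h: "h \<in> hom E T P" "p \<cdot> h = m"
        and hk: "\<forall>k\<in>hom E VT Q. q \<cdot> k = h \<cdot> r \<and> g \<cdot> k = n \<longrightarrow> \<epsilon> \<cdot> k = \<phi>'"
        using univ[rule_format, OF m(1) pbn \<phi>'(1,3)] by blast
      have "qB \<cdot> \<epsilon> \<cdot> k = \<phi>" if k: "k \<in> hom E VT Q" "qV \<cdot> g \<cdot> k = v" "q \<cdot> k = h \<cdot> r" for k
      proof -
        \<comment> \<open>The hypotheses on \<open>k\<close> concern \<open>V\<close> and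
          \<open>P\<close>; comparing both projections of \<open>AV\<close> turns them into the
          equation that the dependent product asks for.\<close>
        have "g \<cdot> k = n"
          by (rule pullback_eq[OF pbV, of _ VT])
            (use k n q qV eqQ[symmetric, THEN reassoc, of k] h(2)[THEN reassoc, of r] p h(1) v m(1)
              in \<open>simp_all add: hom_def\<close>)
        then have "\<epsilon> \<cdot> k = \<phi>'" using hk k by blast
        then show ?thesis using \<phi>'(2) k(1) \<epsilon>(1) qB by (simp add: hom_def)
      qed
      moreover have "pA \<cdot> p \<cdot> h = a" "pU \<cdot> p \<cdot> h = w" using h m p pAU by (simp_all add: hom_def)
      ultimately show "\<exists>h. h \<in> hom E T P \<and> pA \<cdot> p \<cdot> h = a \<and> pU \<cdot> p \<cdot> h = w \<and>
        (\<forall>k\<in>hom E VT' Q. qV \<cdot> g \<cdot> k = v \<and> q \<cdot> k = h \<cdot> r \<longrightarrow> qB \<cdot> \<epsilon> \<cdot> k = \<phi>)"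
        using h(1) unfolding VT by blast
    qed
  qed
qed

text \<open>Now the arrow \<open>V\<^sub>w \<rightarrow> B\<^sub>a\<close> is required to be a cover: \<open>C\<close> is cut out of \<open>P\<close> by the condition
  that the image \<open>I\<close> of the evaluation \<open>P \<times>\<^sub>U V \<rightarrow> P \<times>\<^sub>A B\<close> contains the whole fibre.\<close>

lemma fibre_covers_object_exists:
  assumes lcc: "locally_cartesian_closed E" and f: "f \<in> hom E B A" and \<pi>: "\<pi> \<in> hom E V U"
  obtains a0 C w0 v0 g D q where "a0 \<in> hom E C A" "w0 \<in> hom E C U" "is_pullback E v0 g \<pi> w0"
    "v0 \<in> hom E D V" "g \<in> hom E D C" "q \<in> hom E D B" "quasi_pullback q g f a0"
    "\<forall>T a w v r \<phi>. a \<in> hom E T A \<longrightarrow> w \<in> hom E T U \<longrightarrow> is_pullback E v r \<pi> w \<longrightarrow>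
      quasi_pullback \<phi> r f a \<longrightarrow>
      (\<exists>c s. c \<in> hom E T C \<and> a0 \<cdot> c = a \<and> is_pullback E s r g c \<and> q \<cdot> s = \<phi>)"
proof -
  obtain aP P wP vP rP VP \<phi>P where P: "aP \<in> hom E P A" "wP \<in> hom E P U"
    and pbP: "is_pullback E vP rP \<pi> wP"
    and VP: "vP \<in> hom E VP V" "rP \<in> hom E VP P" "\<phi>P \<in> hom E VP B" and eqP: "f \<cdot> \<phi>P = aP \<cdot> rP"
    and univP: "\<forall>T a w v r VT \<phi>. a \<in> hom E T A \<longrightarrow> w \<in> hom E T U \<longrightarrow> is_pullback E v r \<pi> w \<longrightarrow>
      \<phi> \<in> hom E VT B \<longrightarrow> f \<cdot> \<phi> = a \<cdot> r \<longrightarrow>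
      (\<exists>h. h \<in> hom E T P \<and> aP \<cdot> h = a \<and> wP \<cdot> h = w \<and>
        (\<forall>k\<in>hom E VT VP. vP \<cdot> k = v \<and> rP \<cdot> k = h \<cdot> r \<longrightarrow> \<phi>P \<cdot> k = \<phi>))"
    by (rule fibre_maps_object_exists[OF lcc f \<pi>])
  obtain bQ cQ Q where pbQ: "is_pullback E bQ cQ f aP" and Q: "bQ \<in> hom E Q B" "cQ \<in> hom E Q P"
    using pullback_exists[OF f P(1)] .
  have doms: "Dom E f = B" "Dom E aP = P" "Dom E bQ = Q" "Dom E \<pi> = V" "Dom E wP = P" "Dom E vP = VP"
    "Dom E rP = VP" "Dom E cQ = Q"
    using f P Q \<pi> VP by (auto simp: hom_def)
  obtain \<kappa> where \<kappa>: "\<kappa> \<in> hom E VP Q" "bQ \<cdot> \<kappa> = \<phi>P" "cQ \<cdot> \<kappa> = rP"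
    using pullback_fac[OF pbQ, of \<phi>P VP rP] VP eqP unfolding doms by metis
  obtain e m I where e: "is_cover E e" "e \<in> hom E VP I" and m: "is_mono E m" "m \<in> hom E I Q" and me: "m \<cdot> e = \<kappa>"
    using cover_mono_factorisation[OF \<kappa>(1)] by metis
  \<comment> \<open>The dependent product of the mono \<open>m\<close> along \<open>cQ\<close> is
    universal quantification: lifting \<open>h : T \<rightarrow> P\<close> to \<open>C\<close>
    amounts to factoring the pullback of \<open>Q\<close> along \<open>h\<close> through
    \<open>I\<close>.\<close>
  obtain p C qq gg C' \<epsilon> where p: "p \<in> hom E C P" and pbC: "is_pullback E qq gg p cQ"
    and qq: "qq \<in> hom E C' C" "gg \<in> hom E C' Q" and \<epsilon>: "\<epsilon> \<in> hom E C' I" "m \<cdot> \<epsilon> = gg"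
    and univ: "\<forall>T x q' g' Q' f. x \<in> hom E T P \<longrightarrow> is_pullback E q' g' x cQ \<longrightarrow> f \<in> hom E Q' I \<longrightarrow> m \<cdot> f = g' \<longrightarrow>
      (\<exists>h. h \<in> hom E T C \<and> p \<cdot> h = x \<and> (\<forall>k\<in>hom E Q' C'. qq \<cdot> k = h \<cdot> q' \<and> gg \<cdot> k = g' \<longrightarrow> \<epsilon> \<cdot> k = f))"
    by (rule dependent_product_exists[OF lcc Q(2) m(2)])
  have pbC': "is_pullback E (bQ \<cdot> gg) qq f (aP \<cdot> p)"
    by (rule pullback_paste[OF pbQ pullback_flip[OF pbC]])
  obtain d g D where pbD: "is_pullback E d g rP p" and D: "d \<in> hom E D VP" "g \<in> hom E D C"
    using pullback_exists[OF VP(2) p] .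
  have eqs: "p \<cdot> qq = cQ \<cdot> gg" "rP \<cdot> d = p \<cdot> g"
    using pbC pbD by (auto simp: is_pullback_def comm_square_def)
  have pbV: "is_pullback E (vP \<cdot> d) g \<pi> (wP \<cdot> p)"
    by (rule pullback_paste[OF pbP pbD])
  have dC: "Dom E p = C" "Dom E qq = C'" "Dom E d = D" using p qq D by (auto simp: hom_def)
  have "\<kappa> \<cdot> d \<in> hom E D Q" "p \<cdot> g = cQ \<cdot> (\<kappa> \<cdot> d)"
    using \<kappa>(1) D Q \<kappa>(3)[THEN reassoc, of d] eqs by (simp_all add: hom_def)
  \<comment> \<open>By \<open>pbC'\<close>, the object \<open>C'\<close> is the pullback of
    \<open>f\<close> along \<open>aP \<cdot> p\<close>; \<open>j\<close> is the comparison from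
    \<open>D\<close> to it.\<close>
  then obtain j where j: "j \<in> hom E D C'" "qq \<cdot> j = g" "gg \<cdot> j = \<kappa> \<cdot> d"
    using pullback_fac[OF pbC, of g D "\<kappa> \<cdot> d"] D(2) unfolding doms dC by metis
  have ed: "e \<cdot> d = \<epsilon> \<cdot> j"
    by (rule monoD[OF m, of _ D])
      (use e(2) D \<epsilon>(1) j me[THEN reassoc, of d] \<epsilon>(2)[THEN reassoc, of j] m(2) in \<open>simp_all add: hom_def\<close>)
  \<comment> \<open>As \<open>\<epsilon>\<close> maps \<open>C'\<close> into the image
    \<open>I\<close>, the arrow \<open>j\<close> is a pullback of the cover \<open>e\<close> onto
    that image, hence a cover.\<close>
  have pb_ed: "is_pullback E d j e \<epsilon>"
  proof (rule pullbackI[OF D(1) j(1) e(2) \<epsilon>(1) ed])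
    fix T x y assume x: "x \<in> hom E T VP" and y: "y \<in> hom E T C'" and xy: "e \<cdot> x = \<epsilon> \<cdot> y"
    have ky: "\<kappa> \<cdot> x = gg \<cdot> y"
      using me[THEN reassoc, of x] \<epsilon>(2)[THEN reassoc, of y] x y xy e(2) \<epsilon>(1) m(2) by (simp add: hom_def)
    have "rP \<cdot> x = p \<cdot> (qq \<cdot> y)"
      using \<kappa>(3)[THEN reassoc, of x] eqs(1)[THEN reassoc, of y] ky x y \<kappa>(1) Q qq p by (simp add: hom_def)
    moreover have "qq \<cdot> y \<in> hom E T C" using qq y by (simp add: hom_def)
    ultimately obtain l where l: "l \<in> hom E T D" "d \<cdot> l = x" "g \<cdot> l = qq \<cdot> y"
      using pullback_fac[OF pbD, of x T "qq \<cdot> y"] x unfolding doms dC by metis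
    have "j \<cdot> l = y"
      by (rule pullback_eq[OF pbC, of _ T])
        (use l j(1) y qq D \<kappa>(1) j(2,3)[THEN reassoc, of l] ky in \<open>simp_all add: hom_def\<close>)
    then show "\<exists>u. u \<in> hom E T D \<and> d \<cdot> u = x \<and> j \<cdot> u = y" using l by blast
  next
    fix T u v assume uv: "u \<in> hom E T D" "v \<in> hom E T D" "d \<cdot> u = d \<cdot> v" "j \<cdot> u = j \<cdot> v"
    show "u = v"
      by (rule pullback_eq[OF pbD, of _ T])
        (use uv D j(1) qq j(2)[THEN reassoc, of u] j(2)[THEN reassoc, of v] in \<open>simp_all add: hom_def\<close>)
  qed
  have "quasi_pullback ((bQ \<cdot> gg) \<cdot> j) (qq \<cdot> j) f (aP \<cdot> p)"
    using quasi_pullbackI[OF pbC' cover_pullback[OF pb_ed e(1)], of D] j(1) qq Q by (simp add: hom_def)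
  moreover have "(bQ \<cdot> gg) \<cdot> j = \<phi>P \<cdot> d"
    using j \<kappa> D Q qq \<kappa>(2)[THEN reassoc, of d] by (simp add: hom_def)
  ultimately have qp: "quasi_pullback (\<phi>P \<cdot> d) g f (aP \<cdot> p)" using j(2) by simp
  show thesis
  proof (rule that[of "aP \<cdot> p" C "wP \<cdot> p" "vP \<cdot> d" g D "\<phi>P \<cdot> d"])
    show "aP \<cdot> p \<in> hom E C A" "wP \<cdot> p \<in> hom E C U" "is_pullback E (vP \<cdot> d) g \<pi> (wP \<cdot> p)"
      "vP \<cdot> d \<in> hom E D V" "g \<in> hom E D C" "\<phi>P \<cdot> d \<in> hom E D B"
      "quasi_pullback (\<phi>P \<cdot> d) g f (aP \<cdot> p)"
      using p P D VP pbV qp by (simp_all add: hom_def)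
    show "\<forall>T a w v r \<phi>. a \<in> hom E T A \<longrightarrow> w \<in> hom E T U \<longrightarrow> is_pullback E v r \<pi> w \<longrightarrow>
      quasi_pullback \<phi> r f a \<longrightarrow>
      (\<exists>c s. c \<in> hom E T C \<and> aP \<cdot> p \<cdot> c = a \<and> is_pullback E s r g c \<and> \<phi>P \<cdot> d \<cdot> s = \<phi>)"
    proof (intro allI impI)
      fix T a w v r \<phi>
      assume a: "a \<in> hom E T A" and w: "w \<in> hom E T U" and pb: "is_pullback E v r \<pi> w"
        and qpT: "quasi_pullback \<phi> r f a"
      obtain VT where v: "v \<in> hom E VT V" "r \<in> hom E VT T" "\<pi> \<cdot> v = w \<cdot> r"
        using pb w \<pi> by (elim pullbackE) (auto simp: hom_def)
      have \<phi>: "\<phi> \<in> hom E VT B" "f \<cdot> \<phi> = a \<cdot> r"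
        using qpT a v f by (auto simp: quasi_pullback_def comm_square_def hom_def)
      obtain h where h: "h \<in> hom E T P" "aP \<cdot> h = a" "wP \<cdot> h = w"
        and hk: "\<forall>k\<in>hom E VT VP. vP \<cdot> k = v \<and> rP \<cdot> k = h \<cdot> r \<longrightarrow> \<phi>P \<cdot> k = \<phi>"
        using univP a w pb \<phi> by meson
      have hr: "h \<cdot> r \<in> hom E VT P" "wP \<cdot> (h \<cdot> r) = w \<cdot> r"
        using h(1) v P h(3)[THEN reassoc, of r] by (simp_all add: hom_def)
      then obtain k where k: "k \<in> hom E VT VP" "vP \<cdot> k = v" "rP \<cdot> k = h \<cdot> r"
        using pullback_fac[OF pbP, of v VT "h \<cdot> r"] v unfolding doms by metis
      have \<phi>k: "\<phi>P \<cdot> k = \<phi>" using hk k by blast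
      obtain bT cT QT where pbT: "is_pullback E bT cT f a" and T: "bT \<in> hom E QT B" "cT \<in> hom E QT T"
        using pullback_exists[OF f a] .
      have eqT: "f \<cdot> bT = a \<cdot> cT" using pbT by (simp add: is_pullback_def comm_square_def)
      have da: "Dom E a = T" "Dom E bT = QT" using a T by (auto simp: hom_def)
      obtain uT where uT: "uT \<in> hom E VT QT" "bT \<cdot> uT = \<phi>" "cT \<cdot> uT = r"
        using pullback_fac[OF pbT, of \<phi> VT r] \<phi> v unfolding doms da by metis
      have cov: "is_cover E uT" using quasi_pullback_cover[OF qpT pbT _ uT(2,3)] uT(1) da by blast
      have "h \<cdot> cT \<in> hom E QT P" "f \<cdot> bT = aP \<cdot> (h \<cdot> cT)"
        using h(1) T P h(2)[THEN reassoc, of cT] eqT by (simp_all add: hom_def)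
      then obtain l where l: "l \<in> hom E QT Q" "bQ \<cdot> l = bT" "cQ \<cdot> l = h \<cdot> cT"
        using pullback_fac[OF pbQ, of bT QT "h \<cdot> cT"] T unfolding doms by metis
      \<comment> \<open>The pullback \<open>QT\<close> of \<open>f\<close> along \<open>a\<close> is
        also that of \<open>cQ\<close> along \<open>h\<close>, the form required for lifting
        \<open>h\<close> to \<open>C\<close>.\<close>
      have pbl: "is_pullback E cT l h cQ"
        using pullback_flip[OF pullback_cancel[OF pbQ _ l(1) Q(2) h(1) l(3,2)]] pbT h(2) by blast
      have "\<kappa> \<cdot> k = l \<cdot> uT"
        by (rule pullback_eq[OF pbQ, of _ VT])
          (use \<kappa>(1) k l(1) uT Q T h(1) \<phi>k \<kappa>(2,3)[THEN reassoc, of k] l(2,3)[THEN reassoc, of uT]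
            in \<open>simp_all add: hom_def\<close>)
      then have "m \<cdot> (e \<cdot> k) = l \<cdot> uT"
        using me[THEN reassoc, of k] k(1) e(2) m(2) by (simp add: hom_def)
      moreover have "e \<cdot> k \<in> hom E VT I" using e(2) k(1) by (simp add: hom_def)
      \<comment> \<open>The cover \<open>uT\<close> is orthogonal to \<open>m\<close>, so all of
        \<open>QT\<close>, and not only what comes from \<open>VT\<close>, is mapped into
        \<open>I\<close>.\<close>
      ultimately obtain y where "y \<in> hom E QT I" "m \<cdot> y = l"
        using cover_mono_lift[OF cov uT(1) m _ l(1)] by metis
      then obtain c where c: "c \<in> hom E T C" "p \<cdot> c = h" using univ[rule_format, OF h(1) pbl] by blast
      have "rP \<cdot> k = p \<cdot> (c \<cdot> r)" "c \<cdot> r \<in> hom E VT C"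
        using k(3) c v p c(2)[THEN reassoc, of r] by (simp_all add: hom_def)
      then obtain s where s: "s \<in> hom E VT D" "d \<cdot> s = k" "g \<cdot> s = c \<cdot> r"
        using pullback_fac[OF pbD, of k VT "c \<cdot> r"] k(1) unfolding doms dC by metis
      have ac: "aP \<cdot> p \<cdot> c = a" "wP \<cdot> p \<cdot> c = w" using c h P p by (simp_all add: hom_def)
      have vs: "vP \<cdot> d \<cdot> s = v" "\<phi>P \<cdot> d \<cdot> s = \<phi>" using s k \<phi>k D VP by (simp_all add: hom_def)
      have "is_pullback E s r g c"
        using pullback_cancel[OF pbV _ s(1) D(2) c(1) s(3) vs(1)] pb ac(2) by simp
      then show "\<exists>c s. c \<in> hom E T C \<and> aP \<cdot> p \<cdot> c = a \<and> is_pullback E s r g c \<and> \<phi>P \<cdot> d \<cdot> s = \<phi>"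
        using c ac vs by blast
    qed
  qed
qed

lemma RP_imp_SAMC:
  assumes lcc: "locally_cartesian_closed E" and RP: "RP E"
  shows "SAMC E"
  unfolding SAMC_def
proof
  fix f assume fM: "f \<in> Mor E"
  then obtain S \<pi> where S: "small_class E S" "f \<in> S" and rep: "representation E S \<pi>"
    using RP unfolding RP_def representable_def by blast
  have "S \<subseteq> Mor E" and small_pb: "\<And>q g f p. is_pullback E q g f p \<Longrightarrow> f \<in> S \<Longrightarrow> g \<in> S"
    and coll: "\<And>p f. is_cover E p \<Longrightarrow> f \<in> S \<Longrightarrow> Cod E p = Dom E f \<Longrightarrow>
        \<exists>q g b k. covering_square E q g f b \<and> g \<in> S \<and> k \<in> hom E (Dom E q) (Dom E p) \<and> q = p \<cdot> k"
    using S(1) unfolding small_class_def by blast+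
  have \<pi>S: "\<pi> \<in> S" and repD: "\<And>f. f \<in> S \<Longrightarrow> \<exists>q g p. is_pullback E q g \<pi> p \<and> covers E g f"
    using rep by (auto simp: representation_def)
  have "\<pi> \<in> Mor E" using \<pi>S \<open>S \<subseteq> Mor E\<close> by blast
  then obtain V U where \<pi>: "\<pi> \<in> hom E V U" by (auto simp: hom_def)
  obtain B A where f: "f \<in> hom E B A" using fM by (auto simp: hom_def)
  obtain a0 C w0 v0 g D q where C: "a0 \<in> hom E C A" "w0 \<in> hom E C U"
    and pbg: "is_pullback E v0 g \<pi> w0"
    and D: "v0 \<in> hom E D V" "g \<in> hom E D C" "q \<in> hom E D B" and qp: "quasi_pullback q g f a0"
    and univ: "\<forall>T a w v r \<phi>. a \<in> hom E T A \<longrightarrow> w \<in> hom E T U \<longrightarrow> is_pullback E v r \<pi> w \<longrightarrow>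
      quasi_pullback \<phi> r f a \<longrightarrow>
      (\<exists>c s. c \<in> hom E T C \<and> a0 \<cdot> c = a \<and> is_pullback E s r g c \<and> q \<cdot> s = \<phi>)"
    by (rule fibre_covers_object_exists[OF lcc f \<pi>])
  \<comment> \<open>Some pullback of \<open>\<pi>\<close> covers \<open>f\<close> over a cover
    \<open>a\<close>. Its classifying map \<open>c\<close> satisfies
    \<open>a0 \<cdot> c = a\<close>, and the second factor of a cover is a cover.\<close>
  have a0: "is_cover E a0"
  proof -
    obtain v r w where pb: "is_pullback E v r \<pi> w" and "covers E r f" using repD S(2) by blast
    then obtain \<phi> a where "covering_square E \<phi> r f a" by (auto simp: covers_def)
    then have a: "is_cover E a" and qpa: "quasi_pullback \<phi> r f a" by (auto simp: covering_square_iff)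
    have "a \<in> hom E (Dom E a) A" "w \<in> hom E (Dom E a) U"
      using pb qpa f \<pi> by (auto simp: is_pullback_def quasi_pullback_def comm_square_def hom_def)
    then obtain c where "c \<in> hom E (Dom E a) C" "a0 \<cdot> c = a" using univ pb qpa by blast
    then show ?thesis using cover_comp_right[of a0 c] a C by blast
  qed
  have "strong_collection_square E q g f a0"
    unfolding strong_collection_square_def
  proof (intro conjI allI impI)
    show sq: "comm_square E q g f a0" using qp by (simp add: quasi_pullback_def)
    fix c x y e
    assume *: "is_pullback E y x g c \<and> is_cover E e \<and> Cod E e = Dom E x"
    then have pbx: "is_pullback E y x g c" and e: "is_cover E e" by auto
    obtain X T where x: "y \<in> hom E X D" "x \<in> hom E X T" "c \<in> hom E T C" "g \<cdot> y = c \<cdot> x"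
      using pbx D by (elim pullbackE) (auto simp: hom_def)
    obtain Y where eY: "e \<in> hom E Y X" using * x by (auto simp: is_cover_def hom_def)
    have dx: "Dom E x = X" "Dom E e = Y" "Dom E c = T" "Dom E a0 = C"
      using x eY C by (auto simp: hom_def)
    \<comment> \<open>As a pullback of \<open>g\<close>, itself a pullback of \<open>\<pi>\<close>,
      the map \<open>x\<close> is small. So (S3) refines \<open>e\<close> by a small
      \<open>g1\<close>, which is in turn covered by a pullback \<open>r2\<close> of
      \<open>\<pi>\<close>.\<close>
    have "x \<in> S" using small_pb[OF pbx small_pb[OF pbg \<pi>S]] .
    then obtain q1 g1 b1 k1 where cov1: "covering_square E q1 g1 x b1" and "g1 \<in> S"
      and k1: "k1 \<in> hom E (Dom E q1) Y" "q1 = e \<cdot> k1"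
      using coll[OF e] * dx by metis
    then obtain v2 r2 w2 where pb2: "is_pullback E v2 r2 \<pi> w2" and "covers E r2 g1"
      using repD by blast
    then obtain q2 b2 where cov2: "covering_square E q2 r2 g1 b2" by (auto simp: covers_def)
    obtain Z T1 where Z: "q1 \<in> hom E Z X" "g1 \<in> hom E Z T1" "b1 \<in> hom E T1 T" "x \<cdot> q1 = b1 \<cdot> g1"
      using cov1 x by (auto simp: covering_square_def comm_square_def hom_def)
    obtain V2 T2 where V2: "q2 \<in> hom E V2 Z" "r2 \<in> hom E V2 T2" "b2 \<in> hom E T2 T1" "g1 \<cdot> q2 = b2 \<cdot> r2"
      using cov2 Z by (auto simp: covering_square_def comm_square_def hom_def)
    have w2: "w2 \<in> hom E T2 U"
      using pb2 V2 \<pi> by (auto simp: is_pullback_def comm_square_def hom_def)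
    have k1': "k1 \<in> hom E Z Y" using k1 Z by (simp add: hom_def)
    define t where "t = b1 \<cdot> b2"
    have t: "t \<in> hom E T2 T" using Z V2 by (simp add: t_def hom_def)
    have "covering_square E (q1 \<cdot> q2) r2 x t"
      unfolding t_def by (rule covering_square_paste[OF cov1 cov2])
    then have tc: "is_cover E t" and qp12: "quasi_pullback (q1 \<cdot> q2) r2 x t"
      by (simp_all add: covering_square_iff)
    then have eq12: "x \<cdot> (q1 \<cdot> q2) = t \<cdot> r2"
      by (simp add: quasi_pullback_def comm_square_def)
    obtain u x'' X'' where pbu: "is_pullback E u x'' x t" and u: "u \<in> hom E X'' X" "x'' \<in> hom E X'' T2"
      using pullback_exists[OF x(2) t] .
    have equ: "x \<cdot> u = t \<cdot> x''" using pbu by (simp add: is_pullback_def comm_square_def)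
    have pb'': "is_pullback E (y \<cdot> u) x'' g (c \<cdot> t)" by (rule pullback_paste[OF pbx pbu])
    have ct: "Cod E t = T" and du: "Dom E u = X''" "Dom E t = T2" "Dom E x'' = X''" using u t by (auto simp: hom_def)
    have "q1 \<cdot> q2 \<in> hom E V2 X" using Z V2 by (simp add: hom_def)
    \<comment> \<open>The comparison with the pullback of \<open>x\<close> along \<open>t\<close>;
      it is a cover since the pasted square is a covering square.\<close>
    then obtain h where h: "h \<in> hom E V2 X''" "u \<cdot> h = q1 \<cdot> q2" "x'' \<cdot> h = r2"
      using pullback_fac[OF pbu, of "q1 \<cdot> q2" V2 r2] V2(2) eq12 unfolding dx du by metis
    have hc: "is_cover E h" using quasi_pullback_cover[OF qp12 pbu _ h(2,3)] h(1) du by blast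
    \<comment> \<open>Followed by the fibre cover that \<open>c \<cdot> t\<close> names,
      \<open>h\<close> gives a fibre cover from \<open>r2\<close> to \<open>f\<close> over
      \<open>a0 \<cdot> (c \<cdot> t)\<close>. Its classifying map is \<open>c'\<close>, which
      exhibits \<open>r2\<close> as the pullback of \<open>g\<close> along
      \<open>c'\<close>.\<close>
    have "quasi_pullback (q \<cdot> (y \<cdot> u)) x'' f (a0 \<cdot> (c \<cdot> t))"
      by (rule quasi_pullback_paste[OF qp quasi_pullback_of_pullback[OF pb'']])
    then have "quasi_pullback (q \<cdot> (y \<cdot> u) \<cdot> h) (x'' \<cdot> h) f (a0 \<cdot> (c \<cdot> t))"
      by (rule quasi_pullback_comp_cover[OF _ hc, of _ _ _ _ V2])
        (use h(1) D x u in \<open>simp add: hom_def\<close>)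
    then have "quasi_pullback (q \<cdot> (y \<cdot> u) \<cdot> h) r2 f (a0 \<cdot> (c \<cdot> t))" using h(3) by simp
    moreover have "a0 \<cdot> (c \<cdot> t) \<in> hom E T2 A" using C x t by (simp add: hom_def)
    ultimately obtain c' s where c': "c' \<in> hom E T2 C" "a0 \<cdot> c' = a0 \<cdot> (c \<cdot> t)"
      and pbs: "is_pullback E s r2 g c'" and s: "q \<cdot> s = q \<cdot> (y \<cdot> u) \<cdot> h"
      using univ w2 pb2 by blast
    have xe: "x \<cdot> e \<in> hom E Y T" using x eY by (simp add: hom_def)
    obtain b a W where pba: "is_pullback E b a (x \<cdot> e) t" and W: "b \<in> hom E W Y" "a \<in> hom E W T2"
      using pullback_exists[OF xe t] .
    have eqa: "x \<cdot> (e \<cdot> b) = t \<cdot> a"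
      using pba x eY W by (auto simp: is_pullback_def comm_square_def hom_def)
    have dW: "Dom E (x \<cdot> e) = Y" "Dom E b = W" "Dom E a = W" "Dom E r2 = V2"
      using xe W V2 by (auto simp: hom_def)
    have "e \<cdot> b \<in> hom E W X" using eY W by (simp add: hom_def)
    then obtain e' where e': "e' \<in> hom E W X''" "u \<cdot> e' = e \<cdot> b" "x'' \<cdot> e' = a"
      using pullback_fac[OF pbu, of "e \<cdot> b" W a] W(2) eqa unfolding dx du by metis
    \<comment> \<open>The square from (S3) came with \<open>q1 = e \<cdot> k1\<close>; this makes
      \<open>h\<close> factor through the pullback \<open>e'\<close> of \<open>e\<close>.\<close>
    have kq: "k1 \<cdot> q2 \<in> hom E V2 Y" using k1' V2 by (simp add: hom_def)
    have ekq: "e \<cdot> (k1 \<cdot> q2) = q1 \<cdot> q2" using k1(2) k1' V2 eY by (simp add: hom_def)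
    have "x \<cdot> e \<cdot> (k1 \<cdot> q2) = t \<cdot> r2" using ekq eq12 kq x eY by (simp add: hom_def)
    then obtain k where k: "k \<in> hom E V2 W" "b \<cdot> k = k1 \<cdot> q2" "a \<cdot> k = r2"
      using pullback_fac[OF pba, of "k1 \<cdot> q2" V2 r2] kq V2(2) unfolding dW du by metis
    have hk: "h = e' \<cdot> k"
      by (rule pullback_eq[OF pbu, of _ V2])
        (use h e' k u W eY ekq e'(2,3)[THEN reassoc, of k] in \<open>simp_all add: hom_def\<close>)
    show "\<exists>t c' x' y' x'' y'' u a b e' h k.
        is_cover E t \<and> Cod E t = Dom E c \<and>
        c' \<in> hom E (Dom E t) (Dom E a0) \<and> a0 \<cdot> c' = a0 \<cdot> (c \<cdot> t) \<and>
        is_pullback E y' x' g c' \<and> is_pullback E y'' x'' g (c \<cdot> t) \<and>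
        u \<in> hom E (Dom E x'') (Dom E x) \<and> x \<cdot> u = t \<cdot> x'' \<and> y \<cdot> u = y'' \<and>
        is_pullback E b a (x \<cdot> e) t \<and>
        e' \<in> hom E (Dom E a) (Dom E x'') \<and> x'' \<cdot> e' = a \<and> u \<cdot> e' = e \<cdot> b \<and>
        is_cover E h \<and> h \<in> hom E (Dom E x') (Dom E x'') \<and>
        x'' \<cdot> h = x' \<and> q \<cdot> y'' \<cdot> h = q \<cdot> y' \<and>
        k \<in> hom E (Dom E x') (Dom E a) \<and> h = e' \<cdot> k"
      \<comment> \<open>The projections of the pullback along \<open>c'\<close> are
        \<open>r2\<close> and \<open>s\<close>; those along \<open>c \<cdot> t\<close> are
        \<open>x''\<close> and \<open>y \<cdot> u\<close>.\<close>
      by (rule exI[of _ t], rule exI[of _ c'], rule exI[of _ r2], rule exI[of _ s],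
          rule exI[of _ x''], rule exI[of _ "y \<cdot> u"], rule exI[of _ u], rule exI[of _ a],
          rule exI[of _ b], rule exI[of _ e'], rule exI[of _ h], rule exI[of _ k],
          intro conjI;
        (unfold dx du dW)?;
        rule tc ct c' pbs pb'' u(1) equ refl pba e' hc h(1,3) s[symmetric] k(1) hk)
  qed
  then show "\<exists>q g p. covering_square E q g f p \<and> strong_collection_square E q g f p"
    using a0 qp covering_square_iff by blast
qed

end

theorem theorem4p3:
  fixes E :: "('o, 'm) cat_struct"
  assumes "category E"
    and "locally_cartesian_closed E"
    and "lextensive E"
    and "regular E"
  shows "RP E \<longleftrightarrow> SAMC E"
proof -
  interpret regular_category E
    using assms by (simp add: regular_category_def regular_category_axioms_def)
  show ?thesis using SAMC_imp_RP RP_imp_SAMC[OF assms(2)] by blast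
qed

end
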